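(* Every locally compact strongly topological gyrogroup $(G,\tau,\oplus)$ has a suitable set.
   Context: All topological spaces are assumed to be Hausdorff. A groupoid $(G,\oplus)$ is a nonempty set with a binary operation; $\mathrm{Aut}(G,\oplus)$ is the set of bijections $f:G\to G$ with $f(x\oplus y)=f(x)\oplus f(y)$. A groupoid $(G,\oplus)$ is a gyrogroup if: (G1) there is a unique identity element $0\in G$ with $0\oplus x=x=x\oplus 0$ for all $x\in G$; (G2) for every $x\in G$ there is a unique inverse $\ominus x\in G$ with $\ominus x\oplus x=0=x\oplus(\ominus x)$; (G3) for all $x,y\in G$ there is $\mathrm{gyr}[x,y]\in\mathrm{Aut}(G,\oplus)$ such that $x\oplus(y\oplus z)=(x\oplus y)\oplus \mathrm{gyr}[x,y](z)$ for all $z\in G$; (G4) $\mathrm{gyr}[x\oplus y,y]=\mathrm{gyr}[x,y]$ for all $x,y\in G$. A subgyrogroup of $G$ is a nonempty subset $H$ which is closed under $\oplus$, such that for all $x,y\in H$ the restriction of $\mathrm{gyr}[x,y]$ to $H$ is a bijective homomorphism of $H$ onto itself, and such that $(H,\oplus|_{H\times H})$ is a gyrogroup. For $A\subseteq G$, $\langle A\rangle$ denotes the subgyrogroup of $G$ generated by $A$ (the smallest subgyrogroup containing $A$). A topological gyrogroup $(G,\tau,\oplus)$ is a gyrogroup $(G,\oplus)$ with a topology $\tau$ such that $\oplus:G\times G\to G$ is jointly continuous and $x\mapsto\ominus x$ is continuous. It is a strongly topological gyrogroup if there is a neighborhood base $\mu$ of $0$ such that $\mathrm{gyr}[x,y](U)=U$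 for all $U\in\mu$ and all $x,y\in G$. A subset $S$ of a topological gyrogroup $G$ is a suitable set for $G$ if $S$ is discrete (in the subspace topology), $\langle S\rangle$ is dense in $G$, and $S\cup\{0\}$ is closed in $G$. *)

theory Defs
  imports "HOL-Analysis.Analysis"
begin

text \<open>
  A groupoid is given by a carrier set and an operation on the ambient type; only the values of
  the operation on the carrier matter.
\<close>

definition gyro_aut :: "'a set \<Rightarrow> ('a \<Rightarrow> 'a \<Rightarrow> 'a) \<Rightarrow> ('a \<Rightarrow> 'a) set" where
  "gyro_aut G add =
     {f. bij_betw f G G \<and> (\<forall>x\<in>G. \<forall>y\<in>G. f (add x y) = add (f x) (f y))}"

definition gyro_zero :: "'a set \<Rightarrow> ('a \<Rightarrow> 'a \<Rightarrow> 'a) \<Rightarrow> 'a" where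
  "gyro_zero G add = (THE e. e \<in> G \<and> (\<forall>x\<in>G. add e x = x \<and> add x e = x))"

definition gyro_inv :: "'a set \<Rightarrow> ('a \<Rightarrow> 'a \<Rightarrow> 'a) \<Rightarrow> 'a \<Rightarrow> 'a" where
  "gyro_inv G add x =
     (THE y. y \<in> G \<and> add y x = gyro_zero G add \<and> add x y = gyro_zero G add)"

definition is_gyration ::
    "'a set \<Rightarrow> ('a \<Rightarrow> 'a \<Rightarrow> 'a) \<Rightarrow> ('a \<Rightarrow> 'a \<Rightarrow> 'a \<Rightarrow> 'a) \<Rightarrow> bool" where
  "is_gyration G add g \<longleftrightarrow>
     (\<forall>x\<in>G. \<forall>y\<in>G. g x y \<in> gyro_aut G add \<and>
        (\<forall>z\<in>G. add x (add y z) = add (add x y) (g x y z))) \<and>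
     (\<forall>x\<in>G. \<forall>y\<in>G. \<forall>z\<in>G. g (add x y) y z = g x y z)"

definition gyrogroup :: "'a set \<Rightarrow> ('a \<Rightarrow> 'a \<Rightarrow> 'a) \<Rightarrow> bool" where
  "gyrogroup G add \<longleftrightarrow>
     G \<noteq> {} \<and> (\<forall>x\<in>G. \<forall>y\<in>G. add x y \<in> G) \<and>
     (\<exists>!e. e \<in> G \<and> (\<forall>x\<in>G. add e x = x \<and> add x e = x)) \<and>
     (\<forall>x\<in>G. \<exists>!y. y \<in> G \<and> add y x = gyro_zero G add \<and> add x y = gyro_zero G add) \<and>
     (\<exists>g. is_gyration G add g)"

text \<open>
  In a gyrogroup the maps \<open>gyr[x,y]\<close> are determined on the carrier by the operation, because left
  translations are injective; see \<open>gyr_eq\<close> and \<open>is_gyration_gyr\<close> below.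
\<close>

definition gyr :: "'a set \<Rightarrow> ('a \<Rightarrow> 'a \<Rightarrow> 'a) \<Rightarrow> 'a \<Rightarrow> 'a \<Rightarrow> 'a \<Rightarrow> 'a" where
  "gyr G add x y z = (THE w. w \<in> G \<and> add x (add y z) = add (add x y) w)"

definition subgyrogroup :: "'a set \<Rightarrow> ('a \<Rightarrow> 'a \<Rightarrow> 'a) \<Rightarrow> 'a set \<Rightarrow> bool" where
  "subgyrogroup G add H \<longleftrightarrow>
     H \<subseteq> G \<and> H \<noteq> {} \<and> (\<forall>x\<in>H. \<forall>y\<in>H. add x y \<in> H) \<and>
     (\<forall>x\<in>H. \<forall>y\<in>H. gyr G add x y \<in> gyro_aut H add) \<and>
     gyrogroup H add"

text \<open>
  The intersection of all subgyrogroups containing \<open>A\<close>; it is itself a subgyrogroup, see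
  \<open>subgyrogroup_gyro_span\<close> below.
\<close>

definition gyro_span :: "'a set \<Rightarrow> ('a \<Rightarrow> 'a \<Rightarrow> 'a) \<Rightarrow> 'a set \<Rightarrow> 'a set" where
  "gyro_span G add A = subgyrogroup G add hull A"

definition topological_gyrogroup :: "'a topology \<Rightarrow> ('a \<Rightarrow> 'a \<Rightarrow> 'a) \<Rightarrow> bool" where
  "topological_gyrogroup T add \<longleftrightarrow>
     gyrogroup (topspace T) add \<and>
     continuous_map (prod_topology T T) T (\<lambda>(x, y). add x y) \<and>
     continuous_map T T (gyro_inv (topspace T) add)"

text \<open>The members of the neighbourhood base are not required to be open.\<close>

definition strongly_topological_gyrogroup :: "'a topology \<Rightarrow> ('a \<Rightarrow> 'a \<Rightarrow> 'a) \<Rightarrow> bool" where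
  "strongly_topological_gyrogroup T add \<longleftrightarrow>
     topological_gyrogroup T add \<and>
     (\<exists>\<mu>. (\<forall>U\<in>\<mu>. U \<subseteq> topspace T \<and>
              (\<exists>V. openin T V \<and> gyro_zero (topspace T) add \<in> V \<and> V \<subseteq> U)) \<and>
          (\<forall>W. openin T W \<and> gyro_zero (topspace T) add \<in> W \<longrightarrow> (\<exists>U\<in>\<mu>. U \<subseteq> W)) \<and>
          (\<forall>U\<in>\<mu>. \<forall>x\<in>topspace T. \<forall>y\<in>topspace T. gyr (topspace T) add x y ` U = U))"

definition suitable_set :: "'a topology \<Rightarrow> ('a \<Rightarrow> 'a \<Rightarrow> 'a) \<Rightarrow> 'a set \<Rightarrow> bool" where
  "suitable_set T add S \<longleftrightarrow>
     S \<subseteq> topspace T \<and>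
     subtopology T S = discrete_topology S \<and>
     T closure_of (gyro_span (topspace T) add S) = topspace T \<and>
     closedin T (S \<union> {gyro_zero (topspace T) add})"

lemma gyro_zero:
  assumes "gyrogroup G add"
  shows "gyro_zero G add \<in> G" "\<And>x. x \<in> G \<Longrightarrow> add (gyro_zero G add) x = x"
    "\<And>x. x \<in> G \<Longrightarrow> add x (gyro_zero G add) = x"
proof -
  have "\<exists>!e. e \<in> G \<and> (\<forall>x\<in>G. add e x = x \<and> add x e = x)"
    using assms unfolding gyrogroup_def by (elim conjE)
  from theI'[OF this]
  show "gyro_zero G add \<in> G" "\<And>x. x \<in> G \<Longrightarrow> add (gyro_zero G add) x = x"
    "\<And>x. x \<in> G \<Longrightarrow> add x (gyro_zero G add) = x"
    unfolding gyro_zero_def by blast+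
qed

lemma gyro_inv:
  assumes "gyrogroup G add" "x \<in> G"
  shows "gyro_inv G add x \<in> G" "add (gyro_inv G add x) x = gyro_zero G add"
    "add x (gyro_inv G add x) = gyro_zero G add"
proof -
  have "\<exists>!y. y \<in> G \<and> add y x = gyro_zero G add \<and> add x y = gyro_zero G add"
    using assms unfolding gyrogroup_def by simp
  from theI'[OF this]
  show "gyro_inv G add x \<in> G" "add (gyro_inv G add x) x = gyro_zero G add"
    "add x (gyro_inv G add x) = gyro_zero G add"
    unfolding gyro_inv_def by blast+
qed

lemma gyrogroup_left_cancel:
  assumes G: "gyrogroup G add" and a: "a \<in> G" and x: "x \<in> G" and y: "y \<in> G"
    and eq: "add a x = add a y"
  shows "x = y"
proof -
  obtain g where g: "is_gyration G add g"
    using G by (auto simp: gyrogroup_def)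
  let ?b = "gyro_inv G add a"
  have b: "?b \<in> G" "add ?b a = gyro_zero G add"
    using gyro_inv[OF G a] by auto
  have bij: "bij_betw (g ?b a) G G"
    using g a b(1) unfolding is_gyration_def gyro_aut_def by blast
  have "add ?b (add a z) = g ?b a z" if "z \<in> G" for z
  proof -
    have "add ?b (add a z) = add (add ?b a) (g ?b a z)"
      using g a b(1) that unfolding is_gyration_def by blast
    also have "\<dots> = g ?b a z"
      using b(2) gyro_zero(2)[OF G] bij_betwE[OF bij] that by simp
    finally show ?thesis .
  qed
  then have "g ?b a x = g ?b a y"
    using x y eq by metis
  then show ?thesis
    using bij x y unfolding bij_betw_def inj_on_def by blast
qed

lemma gyr_eq:
  assumes G: "gyrogroup G add" and g: "is_gyration G add g"
    and x: "x \<in> G" and y: "y \<in> G" and z: "z \<in> G"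
  shows "gyr G add x y z = g x y z"
  unfolding gyr_def
proof (rule the_equality)
  have "bij_betw (g x y) G G" and 1: "add x (add y z) = add (add x y) (g x y z)"
    using g x y z unfolding is_gyration_def gyro_aut_def by blast+
  then have 2: "g x y z \<in> G"
    using z bij_betwE by blast
  show "g x y z \<in> G \<and> add x (add y z) = add (add x y) (g x y z)"
    using 1 2 by blast
  have 3: "add x y \<in> G"
    using G x y by (simp add: gyrogroup_def)
  show "w = g x y z" if "w \<in> G \<and> add x (add y z) = add (add x y) w" for w
    using gyrogroup_left_cancel[OF G 3, of w "g x y z"] that 1 2 by simp
qed

lemma is_gyration_gyr:
  assumes G: "gyrogroup G add"
  shows "is_gyration G add (gyr G add)"
proof -
  obtain g where g: "is_gyration G add g"
    using G by (auto simp: gyrogroup_def)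
  have cl: "\<And>x y. x \<in> G \<Longrightarrow> y \<in> G \<Longrightarrow> add x y \<in> G"
    using G by (auto simp: gyrogroup_def)
  note eq = gyr_eq[OF G g]
  have aut: "gyr G add x y \<in> gyro_aut G add" if "x \<in> G" "y \<in> G" for x y
  proof -
    have "g x y \<in> gyro_aut G add"
      using g that unfolding is_gyration_def by blast
    then show ?thesis
      using that by (simp add: gyro_aut_def eq cl bij_betw_cong[of G "gyr G add x y" "g x y"])
  qed
  then show ?thesis
    using g unfolding is_gyration_def by (simp add: eq cl)
qed

lemma subgyrogroup_zero:
  assumes G: "gyrogroup G add" and H: "subgyrogroup G add H"
  shows "gyro_zero H add = gyro_zero G add"
proof -
  have H': "gyrogroup H add" "H \<subseteq> G"
    using H unfolding subgyrogroup_def by auto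
  let ?e = "gyro_zero H add"
  have e: "?e \<in> H" "?e \<in> G"
    using gyro_zero(1)[OF H'(1)] H'(2) by auto
  have "add ?e ?e = add ?e (gyro_zero G add)"
    using gyro_zero(2)[OF H'(1) e(1)] gyro_zero(3)[OF G e(2)] by simp
  then show ?thesis
    using gyrogroup_left_cancel[OF G e(2) e(2) gyro_zero(1)[OF G]] by blast
qed

lemma subgyrogroup_self:
  assumes "gyrogroup G add"
  shows "subgyrogroup G add G"
  using assms is_gyration_gyr[OF assms]
  by (simp add: subgyrogroup_def is_gyration_def) (simp add: gyrogroup_def)

lemma subgyrogroup_Inter:
  assumes G: "gyrogroup G add" and ne: "\<H> \<noteq> {}" and sub: "\<And>H. H \<in> \<H> \<Longrightarrow> subgyrogroup G add H"
  shows "subgyrogroup G add (\<Inter>\<H>)"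
proof -
  let ?K = "\<Inter>\<H>" and ?e = "gyro_zero G add"
  have KG: "?K \<subseteq> G"
    using ne sub unfolding subgyrogroup_def by blast
  have eK: "?e \<in> ?K"
  proof
    fix H assume "H \<in> \<H>"
    then have "subgyrogroup G add H" by (rule sub)
    moreover from this have "gyrogroup H add"
      unfolding subgyrogroup_def by blast
    ultimately show "?e \<in> H"
      using subgyrogroup_zero[OF G] gyro_zero(1) by metis
  qed
  have cl: "\<forall>x\<in>?K. \<forall>y\<in>?K. add x y \<in> ?K"
    using sub unfolding subgyrogroup_def by blast
  have invK: "gyro_inv G add x \<in> ?K" if x: "x \<in> ?K" for x
  proof
    fix H assume H: "H \<in> \<H>"
    then have s: "subgyrogroup G add H" by (rule sub)
    then have g: "gyrogroup H add" and HG: "H \<subseteq> G"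
      unfolding subgyrogroup_def by auto
    have xH: "x \<in> H" and xG: "x \<in> G" using x H HG by auto
    have y: "gyro_inv H add x \<in> H" "add x (gyro_inv H add x) = ?e"
      using gyro_inv[OF g xH] subgyrogroup_zero[OF G s] by auto
    have "gyro_inv H add x = gyro_inv G add x"
      using gyrogroup_left_cancel[OF G xG] y gyro_inv[OF G xG] HG by (metis subsetD)
    then show "gyro_inv G add x \<in> H" using y by simp
  qed
  note gy = is_gyration_gyr[OF G, unfolded is_gyration_def]
  have aut: "gyr G add x y \<in> gyro_aut ?K add" if "x \<in> ?K" "y \<in> ?K" for x y
  proof -
    have A: "gyr G add x y \<in> gyro_aut G add"
      using gy that KG by blast
    then have inj: "inj_on (gyr G add x y) G"
      unfolding gyro_aut_def bij_betw_def by blast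
    have im: "gyr G add x y ` H = H" "H \<subseteq> G" if "H \<in> \<H>" for H
      using sub[OF that] \<open>x \<in> ?K\<close> \<open>y \<in> ?K\<close> that
      unfolding subgyrogroup_def gyro_aut_def bij_betw_def by blast+
    obtain H0 where "H0 \<in> \<H>" using ne by blast
    have "gyr G add x y ` ?K = (\<Inter>H\<in>\<H>. gyr G add x y ` H)"
      using image_INT[OF inj, of \<H> "\<lambda>H. H" H0] im(2) \<open>H0 \<in> \<H>\<close> by simp
    also have "\<dots> = ?K" using im(1) by simp
    finally have "bij_betw (gyr G add x y) ?K ?K"
      using inj_on_subset[OF inj KG] unfolding bij_betw_def by blast
    moreover have "gyr G add x y (add a b) = add (gyr G add x y a) (gyr G add x y b)"
      if "a \<in> ?K" "b \<in> ?K" for a b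
      using A subsetD[OF KG that(1)] subsetD[OF KG that(2)] unfolding gyro_aut_def by blast
    ultimately show ?thesis
      unfolding gyro_aut_def by simp
  qed
  have uniq: "e = ?e" if "e \<in> ?K" "\<forall>x\<in>?K. add e x = x \<and> add x e = x" for e
    using that eK gyro_zero(3)[OF G, of e] KG by (metis subsetD)
  have ex1: "\<exists>!e. e \<in> ?K \<and> (\<forall>x\<in>?K. add e x = x \<and> add x e = x)"
  proof (rule ex1I)
    show "?e \<in> ?K \<and> (\<forall>x\<in>?K. add ?e x = x \<and> add x ?e = x)"
      using eK KG gyro_zero[OF G] by blast
  qed (use uniq in blast)
  have zK: "gyro_zero ?K add = ?e"
    using theI'[OF ex1] uniq unfolding gyro_zero_def by blast
  have inv1: "\<exists>!y. y \<in> ?K \<and> add y x = ?e \<and> add x y = ?e" if x: "x \<in> ?K" for x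
  proof (rule ex1I)
    have xG: "x \<in> G" using x KG by blast
    show "gyro_inv G add x \<in> ?K \<and> add (gyro_inv G add x) x = ?e \<and> add x (gyro_inv G add x) = ?e"
      using invK[OF x] gyro_inv[OF G xG] by blast
    show "y = gyro_inv G add x" if "y \<in> ?K \<and> add y x = ?e \<and> add x y = ?e" for y
      using gyrogroup_left_cancel[OF G xG, of y "gyro_inv G add x"] that KG gyro_inv[OF G xG]
      by (metis subsetD)
  qed
  have "is_gyration ?K add (gyr G add)"
    unfolding is_gyration_def
    using aut gy[THEN conjunct1, rule_format, THEN conjunct2, rule_format]
      gy[THEN conjunct2, rule_format] subsetD[OF KG] by (intro conjI ballI) metis+
  then have "gyrogroup ?K add"
    unfolding gyrogroup_def zK
    apply (intro conjI ballI)
    using eK apply fast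
    using cl apply fast
    apply (rule ex1)
    apply (erule inv1)
    by (rule exI)
  then show ?thesis
    unfolding subgyrogroup_def
    apply (intro conjI ballI)
    apply (rule KG)
    using eK apply fast
    using cl apply fast
    apply (erule (1) aut)
    by assumption
qed

lemma subgyrogroup_gyro_span:
  assumes "gyrogroup G add" "A \<subseteq> G"
  shows "subgyrogroup G add (gyro_span G add A)"
  unfolding gyro_span_def hull_def
proof (rule subgyrogroup_Inter[OF assms(1)])
  show "{H. subgyrogroup G add H \<and> A \<subseteq> H} \<noteq> {}"
    using subgyrogroup_self[OF assms(1)] assms(2) by blast
qed simp

end

theory Submission
  imports Defs
begin

text \<open>
  Write \<open>D a b\<close> for \<open>(\<ominus>a) \<oplus> b\<close>. Since \<open>D (a \<oplus> b) (a \<oplus> c) = gyr[a,b] (D b c)\<close>, gyration-stable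
  neighbourhoods of \<open>0\<close> define a left uniformity, and a sequence of them with \<open>D (V\<^bsub>n+1\<^esub>) (V\<^bsub>n+1\<^esub>) \<subseteq> V\<^bsub>n\<^esub>\<close>
  intersects in a subgyrogroup \<open>N\<close> whose cosets partition \<open>G\<close>. A locally finite \<open>E\<close> generates \<open>G\<close> up
  to some compact such \<open>N\<close>: take a maximal separated set \<open>A\<close>, and if \<open>A\<close> is infinite, add points
  \<open>j d \<oplus> d\<close>, where \<open>d\<close> ranges over a countable set dense modulo \<open>N\<close> in a compact neighbourhood of \<open>0\<close>
  and \<open>j\<close> injects it into \<open>A\<close>. Then \<open>N\<close> is shrunk to \<open>0\<close> by Zorn's lemma: along the way one keeps
  a family of \<open>N\<close>-cosets converging to \<open>N\<close> such that every choice of representatives, together with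
  \<open>E\<close>, generates \<open>G\<close> up to \<open>N\<close>. Asking this for every choice replaces the normality of \<open>N\<close>, which is
  not available. To pass from \<open>N\<close> to \<open>N' = N \<inter> \<Inter>V\<^bsub>n\<^esub>\<close>, shrink the old cosets and add the \<open>N'\<close>-cosets of
  finite \<open>V\<^bsub>n+2\<^esub>\<close>-nets of \<open>N \<inter> V\<^bsub>n\<^esub>\<close>; at limits intersect, using compactness.
\<close>

section \<open>Subgyrogroups and chains of compact sets\<close>

lemma subgyrogroup_left_difference_closed:
  assumes G: "gyrogroup G add" and H: "subgyrogroup G add H" and x: "x \<in> H" and y: "y \<in> H"
  shows "add (gyro_inv G add x) y \<in> H"
proof -
  have g: "gyrogroup H add" and HG: "H \<subseteq> G" and cl: "\<And>x y. x \<in> H \<Longrightarrow> y \<in> H \<Longrightarrow> add x y \<in> H"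
    using H unfolding subgyrogroup_def by auto
  have "add x (gyro_inv H add x) = add x (gyro_inv G add x)"
    using gyro_inv(3)[OF g x] gyro_inv(3)[OF G, of x] subgyrogroup_zero[OF G H] x HG by auto
  then have "gyro_inv H add x = gyro_inv G add x"
    using gyrogroup_left_cancel[OF G] gyro_inv(1)[OF g x] gyro_inv(1)[OF G, of x] x HG
    by (meson subsetD)
  then show ?thesis
    using cl gyro_inv(1)[OF g x] y by metis
qed

text \<open>A finite nonempty subfamily of a chain contains its own intersection, so the chain has
  the finite intersection property inside any one of its compact members.\<close>

lemma compact_chain_Inter_nonempty:
  assumes T: "Hausdorff_space T" and "\<C> \<noteq> {}"
    and cpt: "\<And>K. K \<in> \<C> \<Longrightarrow> compactin T K" and ne: "\<And>K. K \<in> \<C> \<Longrightarrow> K \<noteq> {}"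
    and chain: "\<And>K L. K \<in> \<C> \<Longrightarrow> L \<in> \<C> \<Longrightarrow> K \<subseteq> L \<or> L \<subseteq> K"
  shows "\<Inter>\<C> \<noteq> {}"
proof -
  obtain K where K: "K \<in> \<C>" using \<open>\<C> \<noteq> {}\<close> by blast
  have fin: "finite \<F> \<Longrightarrow> \<F> \<subseteq> \<C> \<Longrightarrow> \<F> \<noteq> {} \<Longrightarrow> \<Inter>\<F> \<in> \<F>" for \<F>
  proof (induction \<F> rule: finite_induct)
    case (insert x F)
    show ?case
    proof (cases "F = {}")
      case False
      then have "\<Inter>F \<in> F" using insert by blast
      moreover from this have "x \<subseteq> \<Inter>F \<or> \<Inter>F \<subseteq> x"
        using chain[of x "\<Inter>F"] insert.prems by blast
      ultimately show ?thesis
        by (metis Inter_insert Int_absorb1 Int_absorb2 insertCI)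
    qed simp
  qed simp
  have "K \<inter> \<Inter>\<F> \<noteq> {}" if "finite \<F>" "\<F> \<subseteq> \<C>" for \<F>
  proof -
    have sub: "insert K \<F> \<subseteq> \<C>" using that K by simp
    have "\<Inter>(insert K \<F>) \<in> insert K \<F>"
      by (rule fin) (simp_all add: that K)
    then have "\<Inter>(insert K \<F>) \<in> \<C>" using sub by (rule rev_subsetD)
    then show ?thesis using ne[of "\<Inter>(insert K \<F>)"] by simp
  qed
  moreover have "\<And>C. C \<in> \<C> \<Longrightarrow> closedin T C"
    using cpt compactin_imp_closedin[OF T] by blast
  ultimately have "K \<inter> \<Inter>\<C> \<noteq> {}"
    using cpt[OF K, unfolded compactin_fip, THEN conjunct2, rule_format, of \<C>] by simp
  then show ?thesis by blast
qed

text \<open>If no member lay inside \<open>U\<close>, the compact sets \<open>K - U\<close> would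
  form a chain of nonempty sets, and a common point of these would lie outside
  \<open>U\<close>.\<close>

lemma compact_chain_Inter_subset_open:
  assumes T: "Hausdorff_space T" and ne: "\<C> \<noteq> {}"
    and cpt: "\<And>K. K \<in> \<C> \<Longrightarrow> compactin T K"
    and chain: "\<And>K L. K \<in> \<C> \<Longrightarrow> L \<in> \<C> \<Longrightarrow> K \<subseteq> L \<or> L \<subseteq> K"
    and U: "openin T U" and sub: "\<Inter>\<C> \<subseteq> U"
  shows "\<exists>K\<in>\<C>. K \<subseteq> U"
proof (rule ccontr)
  assume neg: "\<not> ?thesis"
  have "\<Inter>((\<lambda>K. K - U) ` \<C>) \<noteq> {}"
  proof (rule compact_chain_Inter_nonempty[OF T])
    show "compactin T K" if K: "K \<in> (\<lambda>K. K - U) ` \<C>" for K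
    proof -
      obtain L where L: "L \<in> \<C>" "K = L - U" using K by blast
      have "L - U = L \<inter> (topspace T - U)"
        using compactin_subset_topspace[OF cpt[OF L(1)]] by blast
      then show ?thesis
        using L compact_Int_closedin[OF cpt[OF L(1)], of "topspace T - U"] U by auto
    qed
    show "K \<subseteq> L \<or> L \<subseteq> K" if "K \<in> (\<lambda>K. K - U) ` \<C>" "L \<in> (\<lambda>K. K - U) ` \<C>" for K L
    proof -
      obtain K' L' where "K' \<in> \<C>" "L' \<in> \<C>" "K = K' - U" "L = L' - U" using \<open>K \<in> _\<close> \<open>L \<in> _\<close> by blast
      then show ?thesis using chain[of K' L'] by blast
    qed
  qed (use ne neg in auto)
  then show False using sub ne by blast
qed

section \<open>Left differences: algebra and continuity\<close>

locale lc_strong_gyrogroup =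
  fixes T :: "'a topology" and add :: "'a \<Rightarrow> 'a \<Rightarrow> 'a"
  assumes haus: "Hausdorff_space T"
    and lc: "locally_compact_space T"
    and strong: "strongly_topological_gyrogroup T add"
begin

abbreviation "G \<equiv> topspace T"
abbreviation "zero \<equiv> gyro_zero G add"

definition D :: "'a \<Rightarrow> 'a \<Rightarrow> 'a" where
  "D a b = add (gyro_inv G add a) b"

lemma gyro: "gyrogroup G add"
  and cont_add: "continuous_map (prod_topology T T) T (\<lambda>(x, y). add x y)"
  and cont_inv: "continuous_map T T (gyro_inv G add)"
  using strong unfolding strongly_topological_gyrogroup_def topological_gyrogroup_def by auto

lemma add_closed [simp]: "a \<in> G \<Longrightarrow> b \<in> G \<Longrightarrow> add a b \<in> G"
  using gyro unfolding gyrogroup_def by blast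

lemma zero_closed [simp]: "zero \<in> G"
  and zero_add [simp]: "a \<in> G \<Longrightarrow> add zero a = a"
  and add_zero [simp]: "a \<in> G \<Longrightarrow> add a zero = a"
  using gyro_zero[OF gyro] by auto

lemmas neg = gyro_inv[OF gyro]
lemmas left_cancel = gyrogroup_left_cancel[OF gyro]
lemmas gyr = is_gyration_gyr[OF gyro, unfolded is_gyration_def]

lemma D_closed [simp]: "a \<in> G \<Longrightarrow> b \<in> G \<Longrightarrow> D a b \<in> G"
  unfolding D_def using neg by simp

lemma gyr_closed [simp]: "a \<in> G \<Longrightarrow> b \<in> G \<Longrightarrow> c \<in> G \<Longrightarrow> gyr G add a b c \<in> G"
  using gyr unfolding gyro_aut_def bij_betw_def by blast

lemma gyr_assoc: "a \<in> G \<Longrightarrow> b \<in> G \<Longrightarrow> c \<in> G \<Longrightarrow>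
    add a (add b c) = add (add a b) (gyr G add a b c)"
  using gyr by blast

lemma gyr_zero_left: "b \<in> G \<Longrightarrow> c \<in> G \<Longrightarrow> gyr G add zero b c = c"
  using gyr_assoc[of zero b c] left_cancel[of b c "gyr G add zero b c"] by simp

text \<open>Axiom (G4) replaces the first argument by \<open>add (gyro_inv G add b) b\<close>, which
  is \<open>zero\<close>, and gyrations with first argument \<open>zero\<close> are trivial.\<close>

lemma gyr_neg_left:
  assumes "b \<in> G" "c \<in> G" shows "gyr G add (gyro_inv G add b) b c = c"
proof -
  have "gyr G add (add (gyro_inv G add b) b) b c = gyr G add (gyro_inv G add b) b c"
    using gyr assms neg by blast
  then show ?thesis using neg assms gyr_zero_left by simp
qed

lemma neg_neg: "a \<in> G \<Longrightarrow> gyro_inv G add (gyro_inv G add a) = a"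
  by (metis left_cancel neg)

lemma D_add [simp]: "a \<in> G \<Longrightarrow> b \<in> G \<Longrightarrow> D a (add a b) = b"
  unfolding D_def using gyr_assoc[of "gyro_inv G add a" a b] neg gyr_neg_left by simp

lemma add_D [simp]: "a \<in> G \<Longrightarrow> b \<in> G \<Longrightarrow> add a (D a b) = b"
  using D_add[of "gyro_inv G add a" b] neg neg_neg by (simp add: D_def)

lemma D_self [simp]: "a \<in> G \<Longrightarrow> D a a = zero"
  using D_add[of a zero] by simp

lemma D_zero [simp]: "b \<in> G \<Longrightarrow> D zero b = b"
  using D_add[of zero b] by simp

lemma D_add_add:
  assumes "a \<in> G" "b \<in> G" "c \<in> G"
  shows "D (add a b) (add a c) = gyr G add a b (D b c)"
  using gyr_assoc[of a b "D b c"] assms D_add[of "add a b" "gyr G add a b (D b c)"] by simp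

text \<open>This is \<open>D_add_add\<close> applied to \<open>D a b\<close> and
  \<open>D a c\<close>: two points are compared through their positions relative to a third one, at
  the cost of a gyration.\<close>

lemma D_gyr:
  assumes "a \<in> G" "b \<in> G" "c \<in> G"
  shows "D b c = gyr G add a (D a b) (D (D a b) (D a c))"
  using D_add_add[of a "D a b" "D a c"] assms by simp

text \<open>Written in this way a gyration is a composite of translations, so its continuity can be
  read off.\<close>

lemma gyr_as_D:
  "a \<in> G \<Longrightarrow> b \<in> G \<Longrightarrow> c \<in> G \<Longrightarrow> gyr G add a b c = D (add a b) (add a (add b c))"
  using gyr_assoc[of a b c] by simp

lemma cont_D: "continuous_map (prod_topology T T) T (\<lambda>(x, y). D x y)"
proof -
  have "continuous_map (prod_topology T T) (prod_topology T T) (\<lambda>p. (gyro_inv G add (fst p), snd p))"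
    by (intro continuous_intros continuous_map_compose[OF continuous_map_fst cont_inv, unfolded o_def])
  from continuous_map_compose[OF this cont_add] show ?thesis
    by (simp add: o_def D_def case_prod_unfold)
qed

lemma continuous_map_fix_arg:
  assumes f: "continuous_map (prod_topology T T) T (\<lambda>(x, y). f x y)" and a: "a \<in> G"
  shows "continuous_map T T (f a)" and "continuous_map T T (\<lambda>x. f x a)"
proof -
  have "continuous_map T (prod_topology T T) (\<lambda>x. (a, x))"
    "continuous_map T (prod_topology T T) (\<lambda>x. (x, a))"
    using a by (simp_all add: continuous_map_pairwise o_def)
  from this[THEN continuous_map_compose[OF _ f]]
  show "continuous_map T T (f a)" and "continuous_map T T (\<lambda>x. f x a)"
    by (simp_all add: o_def)
qed

lemmas cont_add_args = continuous_map_fix_arg[of add, OF cont_add]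
lemmas cont_D_args = continuous_map_fix_arg[of D, OF cont_D]

lemma cont_gyr:
  assumes "a \<in> G" "b \<in> G" shows "continuous_map T T (gyr G add a b)"
proof -
  have "continuous_map T T (D (add a b) \<circ> (add a \<circ> add b))"
    using assms by (intro continuous_map_compose[of T T _ T] cont_add_args cont_D_args) auto
  then show ?thesis
    by (rule continuous_map_eq) (simp add: gyr_as_D assms)
qed

section \<open>Gyration-stable neighbourhoods and filtrations\<close>

text \<open>
  Inclusion suffices here: \<open>D a b\<close> and \<open>D a c\<close> close to \<open>0\<close> make \<open>D b c\<close> close to \<open>0\<close> by \<open>D_gyr\<close>, and
  together with \<open>D a a = 0\<close> this already gives symmetry and transitivity.
\<close>

definition gyr_stable :: "'a set \<Rightarrow> bool" where
  "gyr_stable V \<longleftrightarrow> V \<subseteq> G \<and> zero \<in> V \<and> (\<forall>x\<in>G. \<forall>y\<in>G. gyr G add x y ` V \<subseteq> V)"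

text \<open>Closure under \<open>D\<close> is the single algebraic condition; closure under inverses
  and sums follows from it since \<open>zero\<close> belongs to \<open>N\<close>.\<close>

definition cpt_sub :: "'a set \<Rightarrow> bool" where
  "cpt_sub N \<longleftrightarrow> compactin T N \<and> gyr_stable N \<and> (\<forall>a\<in>N. \<forall>b\<in>N. D a b \<in> N)"

text \<open>This is the left translate of \<open>N\<close> by \<open>g\<close>
  (\<open>coset_image\<close>), described by a condition on \<open>D\<close> so that intersections
  over \<open>N\<close> are immediate. It also serves as a ball around \<open>g\<close> when
  \<open>N\<close> is a member of a filtration.\<close>

definition coset :: "'a \<Rightarrow> 'a set \<Rightarrow> 'a set" where
  "coset g N = {y \<in> G. D g y \<in> N}"

text \<open>The value \<open>V 0 = G\<close> gives successive approximation a trivial start and lets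
  every nonempty set meet some \<open>V n\<close>. That the sets decrease is derived in
  \<open>filtration_Suc\<close>.\<close>

definition filtration :: "(nat \<Rightarrow> 'a set) \<Rightarrow> bool" where
  "filtration V \<longleftrightarrow> V 0 = G \<and> (\<forall>n. closedin T (V n) \<and> gyr_stable (V n) \<and>
     (\<exists>Q. openin T Q \<and> zero \<in> Q \<and> Q \<subseteq> V n) \<and> (\<forall>a\<in>V (Suc n). \<forall>b\<in>V (Suc n). D a b \<in> V n))"

text \<open>By \<open>D_gyr\<close>, gyration-stability of \<open>U\<close> absorbs the gyration.
  The two sets allow both uses: consecutive members of a filtration, and \<open>U = V = N\<close>
  for a compact subgyrogroup.\<close>

lemma gyr_stable_D_trans:
  assumes "gyr_stable U" "\<And>a b. a \<in> V \<Longrightarrow> b \<in> V \<Longrightarrow> D a b \<in> U"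
    and "a \<in> G" "b \<in> G" "c \<in> G" "D a b \<in> V" "D a c \<in> V"
  shows "D b c \<in> U"
  using D_gyr[of a b c] assms unfolding gyr_stable_def by (auto simp: image_subset_iff)

lemma filtration_trans:
  assumes V: "filtration V" and "a \<in> G" "b \<in> G" "c \<in> G" "D a b \<in> V (Suc n)" "D a c \<in> V (Suc n)"
  shows "D b c \<in> V n"
  using gyr_stable_D_trans[of "V n" "V (Suc n)"] assms unfolding filtration_def by blast

lemma filtration_zero: "filtration V \<Longrightarrow> zero \<in> V n"
  unfolding filtration_def gyr_stable_def by blast

lemma filtration_sym:
  assumes "filtration V" "a \<in> G" "b \<in> G" "D a b \<in> V (Suc n)" shows "D b a \<in> V n"
  using filtration_trans[of V a b a n] filtration_zero assms by simp

lemma filtration_subset: "filtration V \<Longrightarrow> V n \<subseteq> G"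
  unfolding filtration_def gyr_stable_def by blast

lemma filtration_Suc: assumes V: "filtration V" shows "V (Suc n) \<subseteq> V n"
proof
  fix b assume b: "b \<in> V (Suc n)"
  then have "D zero b \<in> V n"
    using V filtration_zero[OF V] unfolding filtration_def by blast
  then show "b \<in> V n" using D_zero[of b] b filtration_subset[OF V, of "Suc n"] by auto
qed

lemma filtration_antimono: "filtration V \<Longrightarrow> m \<le> n \<Longrightarrow> V n \<subseteq> V m"
  using lift_Suc_antimono_le[of V] filtration_Suc[of V] by metis

text \<open>Continuity of \<open>D\<close> at \<open>(zero, zero)\<close> provides a neighbourhood
  whose differences lie in \<open>W\<close>, and regularity leaves room for the closure of a
  gyration-invariant neighbourhood. The closure remains gyration-stable because gyrations are
  continuous.\<close>

lemma filtration_step: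
  assumes W: "openin T W" "zero \<in> W"
  shows "\<exists>V. V \<subseteq> W \<and> closedin T V \<and> gyr_stable V \<and> (\<exists>Q. openin T Q \<and> zero \<in> Q \<and> Q \<subseteq> V)
     \<and> (\<forall>a\<in>V. \<forall>b\<in>V. D a b \<in> W)"
proof -
  define R where "R = {p \<in> topspace (prod_topology T T). (\<lambda>(x, y). D x y) p \<in> W}"
  have "openin (prod_topology T T) R"
    unfolding R_def by (rule openin_continuous_map_preimage[OF cont_D W(1)])
  moreover have "(zero, zero) \<in> R"
    using W unfolding R_def by simp
  ultimately obtain A B where AB: "openin T A" "openin T B" "zero \<in> A" "zero \<in> B" "A \<times> B \<subseteq> R"
    unfolding openin_prod_topology_alt by meson
  define Q where "Q = A \<inter> B \<inter> W"
  have Q: "openin T Q" "zero \<in> Q" unfolding Q_def using AB W by auto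
  have "regular_space T"
    using locally_compact_Hausdorff_imp_regular_space[OF lc haus] .
  then obtain O' where O': "openin T O'" "zero \<in> O'" "T closure_of O' \<subseteq> Q"
    using Q unfolding neighbourhood_base_of_closedin[symmetric] neighbourhood_base_of
    by (meson closure_of_minimal subset_trans)
  obtain \<mu> where mu: "\<forall>U\<in>\<mu>. U \<subseteq> G \<and> (\<exists>V. openin T V \<and> zero \<in> V \<and> V \<subseteq> U)"
    "\<forall>W. openin T W \<and> zero \<in> W \<longrightarrow> (\<exists>U\<in>\<mu>. U \<subseteq> W)"
    "\<forall>U\<in>\<mu>. \<forall>x\<in>G. \<forall>y\<in>G. gyr G add x y ` U = U"
    using strong unfolding strongly_topological_gyrogroup_def by (elim conjE exE)
  obtain U where U: "U \<in> \<mu>" "U \<subseteq> O'" using mu(2) O' by blast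
  have UG: "U \<subseteq> G" using mu(1) U(1) by blast
  obtain Q' where Q': "openin T Q'" "zero \<in> Q'" "Q' \<subseteq> U" using mu(1) U(1) by blast
  let ?V = "T closure_of U"
  have VQ: "?V \<subseteq> Q" using closure_of_mono[OF U(2)] O'(3) by blast
  have sub: "U \<subseteq> ?V" using UG closure_of_subset by blast
  have "gyr G add x y ` ?V \<subseteq> ?V" if "x \<in> G" "y \<in> G" for x y
  proof -
    have "gyr G add x y ` U = U" using mu(3) U(1) that by blast
    then show ?thesis
      using continuous_map_image_closure_subset[OF cont_gyr[OF that], of U] by simp
  qed
  moreover have "zero \<in> ?V" using sub Q' by blast
  ultimately have st: "gyr_stable ?V"
    unfolding gyr_stable_def by (simp add: closure_of_subset_topspace)
  have ex: "\<exists>Q. openin T Q \<and> zero \<in> Q \<and> Q \<subseteq> ?V" using Q' sub by blast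
  have dW: "\<forall>a\<in>?V. \<forall>b\<in>?V. D a b \<in> W"
  proof (intro ballI)
    fix a b assume "a \<in> ?V" "b \<in> ?V"
    then have "(a, b) \<in> A \<times> B" using VQ unfolding Q_def by auto
    from subsetD[OF AB(5) this] show "D a b \<in> W" unfolding R_def by simp
  qed
  have "?V \<subseteq> W" using VQ unfolding Q_def by blast
  then have "?V \<subseteq> W \<and> closedin T ?V \<and> gyr_stable ?V \<and> (\<exists>Q. openin T Q \<and> zero \<in> Q \<and> Q \<subseteq> ?V)
     \<and> (\<forall>a\<in>?V. \<forall>b\<in>?V. D a b \<in> W)"
    using st ex dW by (intro conjI closedin_closure_of)
  then show ?thesis by (rule exI)
qed

lemma filtration_exists:
  assumes W: "openin T W" "zero \<in> W"
  shows "\<exists>V. filtration V \<and> V (Suc 0) \<subseteq> W"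
proof -
  define P where "P = (\<lambda>n V. closedin T V \<and> gyr_stable V \<and> (\<exists>Q. openin T Q \<and> zero \<in> Q \<and> Q \<subseteq> V)
    \<and> (n = 0 \<longrightarrow> V = G) \<and> (n = Suc 0 \<longrightarrow> V \<subseteq> W))"
  have "\<exists>V. \<forall>n. P n (V n) \<and> (\<forall>a\<in>V (Suc n). \<forall>b\<in>V (Suc n). D a b \<in> V n)"
  proof (rule dependent_nat_choice)
    show "\<exists>V. P 0 V"
      unfolding P_def gyr_stable_def by (intro exI[of _ G]) auto
    fix V n assume "P n V"
    then obtain Q where Q: "openin T Q" "zero \<in> Q" "Q \<subseteq> V" unfolding P_def by blast
    \<comment> \<open>Intersecting with \<open>W\<close> at every stage takes care of the demand on
      the member with index \<open>Suc 0\<close>, the first one that is not prescribed to be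
      \<open>G\<close>.\<close>
    have "openin T (Q \<inter> W)" "zero \<in> Q \<inter> W" using Q W by auto
    from filtration_step[OF this] obtain V' where V': "V' \<subseteq> Q \<inter> W" "closedin T V'" "gyr_stable V'"
      "\<exists>Q. openin T Q \<and> zero \<in> Q \<and> Q \<subseteq> V'" "\<forall>a\<in>V'. \<forall>b\<in>V'. D a b \<in> Q \<inter> W"
      by blast
    then show "\<exists>V'. P (Suc n) V' \<and> (\<forall>a\<in>V'. \<forall>b\<in>V'. D a b \<in> V)"
      unfolding P_def using Q by (intro exI[of _ V']) auto
  qed
  then show ?thesis unfolding filtration_def P_def by metis
qed

section \<open>Compact subgyrogroups, cosets and closures of spans\<close>

lemma cpt_subD:
  assumes "cpt_sub N"
  shows "compactin T N" "N \<subseteq> G" "zero \<in> N" "closedin T N"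
    and "\<And>a b. a \<in> N \<Longrightarrow> b \<in> N \<Longrightarrow> D a b \<in> N" "\<And>a b. a \<in> N \<Longrightarrow> b \<in> N \<Longrightarrow> add a b \<in> N"
proof -
  show c: "compactin T N" and s: "N \<subseteq> G" and z: "zero \<in> N"
    and d: "\<And>a b. a \<in> N \<Longrightarrow> b \<in> N \<Longrightarrow> D a b \<in> N"
    using assms unfolding cpt_sub_def gyr_stable_def by auto
  show "closedin T N" using c compactin_imp_closedin haus by blast
  show "add a b \<in> N" if "a \<in> N" "b \<in> N" for a b
  proof -
    \<comment> \<open>The inverse is a difference, hence so is the sum: it equals
      \<open>D (D a zero) b\<close>.\<close>
    have *: "D a zero = gyro_inv G add a" "D a zero \<in> N"
      using d[OF that(1) z] that s neg unfolding D_def by auto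
    then have "D (D a zero) b = add a b"
      unfolding D_def[of "D a zero" b] using neg_neg[of a] that s by auto
    then show ?thesis using d * that by metis
  qed
qed

lemma cpt_sub_trans:
  assumes "cpt_sub N" "a \<in> G" "b \<in> G" "c \<in> G" "D a b \<in> N" "D a c \<in> N"
  shows "D b c \<in> N"
  using gyr_stable_D_trans[of N N] assms unfolding cpt_sub_def by blast

lemma cpt_sub_sym: "cpt_sub N \<Longrightarrow> a \<in> G \<Longrightarrow> b \<in> G \<Longrightarrow> D a b \<in> N \<Longrightarrow> D b a \<in> N"
  using cpt_sub_trans[of N a b a] cpt_subD by simp

lemma coset_subset: "coset g N \<subseteq> G"
  unfolding coset_def by blast

lemma coset_self: "cpt_sub N \<Longrightarrow> g \<in> G \<Longrightarrow> g \<in> coset g N"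
  unfolding coset_def using cpt_subD by simp

lemma coset_eq:
  assumes "cpt_sub N" "g \<in> G" "h \<in> coset g N" shows "coset h N = coset g N"
proof -
  have h: "h \<in> G" "D g h \<in> N" "D h g \<in> N"
    using assms cpt_sub_sym unfolding coset_def by auto
  then show ?thesis
    using cpt_sub_trans[of N] assms unfolding coset_def by blast
qed

lemma coset_zero: "cpt_sub N \<Longrightarrow> coset zero N = N"
  unfolding coset_def using cpt_subD(2)[of N] by auto

lemma coset_image: "N \<subseteq> G \<Longrightarrow> g \<in> G \<Longrightarrow> coset g N = add g ` N"
  unfolding coset_def by (auto simp: image_iff) (metis add_D)

lemma coset_compact:
  assumes "compactin T N" "g \<in> G" shows "compactin T (coset g N)"
  using image_compactin[OF assms(1) cont_add_args(1)] assms compactin_subset_topspace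
  by (metis coset_image)

text \<open>Joint continuity maps the product of the closures into the closure of the sums.
  Differences are needed only in the span itself, to recover generators; sums are needed in the
  closure, to approximate.\<close>

lemma closure_span:
  assumes A: "A \<subseteq> G"
  defines "M \<equiv> T closure_of (gyro_span G add A)"
  shows "A \<subseteq> gyro_span G add A" "gyro_span G add A \<subseteq> M" "closedin T M" "M \<subseteq> G"
    and "\<And>x y. x \<in> gyro_span G add A \<Longrightarrow> y \<in> gyro_span G add A \<Longrightarrow> D x y \<in> gyro_span G add A"
    and "\<And>x y. x \<in> M \<Longrightarrow> y \<in> M \<Longrightarrow> add x y \<in> M" and "zero \<in> gyro_span G add A"
proof -
  let ?H = "gyro_span G add A"
  have H: "subgyrogroup G add ?H" using subgyrogroup_gyro_span[OF gyro A] .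
  then have HG: "?H \<subseteq> G" and ne: "?H \<noteq> {}" and cl: "\<And>x y. x \<in> ?H \<Longrightarrow> y \<in> ?H \<Longrightarrow> add x y \<in> ?H"
    unfolding subgyrogroup_def by auto
  show "A \<subseteq> ?H" unfolding gyro_span_def by (rule hull_subset)
  show HM: "?H \<subseteq> M" unfolding M_def using HG closure_of_subset by blast
  show "closedin T M" "M \<subseteq> G" unfolding M_def by (auto simp: closure_of_subset_topspace)
  show D: "\<And>x y. x \<in> ?H \<Longrightarrow> y \<in> ?H \<Longrightarrow> D x y \<in> ?H"
    unfolding D_def using subgyrogroup_left_difference_closed[OF gyro H] by blast
  have "(\<lambda>(x, y). add x y) ` (M \<times> M) \<subseteq> T closure_of ((\<lambda>(x, y). add x y) ` (?H \<times> ?H))"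
    unfolding M_def closure_of_Times[symmetric] by (rule continuous_map_image_closure_subset[OF cont_add])
  also have "\<dots> \<subseteq> M" unfolding M_def using cl by (intro closure_of_mono) auto
  finally show "\<And>x y. x \<in> M \<Longrightarrow> y \<in> M \<Longrightarrow> add x y \<in> M" by auto
  obtain h where "h \<in> ?H" using ne by blast
  then have "D h h \<in> ?H" "h \<in> G" using D HG by auto
  then show "zero \<in> ?H" by auto
qed

section \<open>Filtrations and compactness\<close>

lemma filtration_neighbourhood:
  assumes V: "filtration V" and p: "p \<in> G"
  shows "\<exists>Q. openin T Q \<and> p \<in> Q \<and> (\<forall>y\<in>Q. D p y \<in> V n)"
proof -
  obtain Q where Q: "openin T Q" "zero \<in> Q" "Q \<subseteq> V n"
    using V unfolding filtration_def by meson
  have "openin T {y \<in> G. D p y \<in> Q}"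
    by (rule openin_continuous_map_preimage[OF cont_D_args(1)[OF p] Q(1)])
  then show ?thesis
    using Q p by (intro exI[of _ "{y \<in> G. D p y \<in> Q}"]) auto
qed

lemma filtration_finite_cover:
  assumes V: "filtration V" and K: "compactin T K"
  shows "\<exists>A. finite A \<and> A \<subseteq> K \<and> (\<forall>g\<in>K. \<exists>a\<in>A. D a g \<in> V n)"
proof -
  have KG: "K \<subseteq> G" using compactin_subset_topspace[OF K] .
  have "\<forall>p\<in>K. \<exists>Q. openin T Q \<and> p \<in> Q \<and> (\<forall>y\<in>Q. D p y \<in> V n)"
    using filtration_neighbourhood[OF V] KG by blast
  from bchoice[OF this]
  obtain Q where Q: "\<And>p. p \<in> K \<Longrightarrow> openin T (Q p) \<and> p \<in> Q p \<and> (\<forall>y\<in>Q p. D p y \<in> V n)"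
    by auto
  have "\<exists>\<F>. finite \<F> \<and> \<F> \<subseteq> Q ` K \<and> K \<subseteq> \<Union>\<F>"
    by (rule compactinD[OF K]) (use Q in auto)
  then obtain \<F> where F: "finite \<F>" "\<F> \<subseteq> Q ` K" "K \<subseteq> \<Union>\<F>" by blast
  from finite_subset_image[OF F(1,2)] F(3)
  obtain A where A: "finite A" "A \<subseteq> K" "K \<subseteq> \<Union>(Q ` A)" by auto
  have "\<exists>a\<in>A. D a g \<in> V n" if "g \<in> K" for g
  proof -
    obtain a where "a \<in> A" "g \<in> Q a" using A(3) \<open>g \<in> K\<close> by blast
    then show ?thesis using Q[of a] A(2) by auto
  qed
  then show ?thesis using A by blast
qed

text \<open>The points of \<open>M\<close> in \<open>K\<close> that are good for \<open>n\<close>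
  form a decreasing sequence of nonempty compact sets, since each \<open>V n\<close> is
  closed.\<close>

lemma filtration_limit_point:
  assumes V: "filtration V" and M: "closedin T M" and K: "compactin T K" and g: "g \<in> G"
    and ex: "\<And>n. \<exists>m\<in>M \<inter> K. D m g \<in> V n"
  shows "\<exists>m\<in>M \<inter> K. \<forall>n. D m g \<in> V n"
proof -
  define C where "C n = K \<inter> (M \<inter> {m \<in> G. D m g \<in> V n})" for n
  have "\<Inter>(range C) \<noteq> {}"
  proof (rule compact_chain_Inter_nonempty[OF haus])
    show "compactin T L" if "L \<in> range C" for L
    proof -
      obtain n where n: "L = C n" using \<open>L \<in> range C\<close> by blast
      have "closedin T (V n)" using V unfolding filtration_def by blast
      then have "closedin T {m \<in> G. D m g \<in> V n}"
        by (rule closedin_continuous_map_preimage[OF cont_D_args(2)[OF g]])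
      then show ?thesis unfolding n C_def
        using M K by (intro compact_Int_closedin closedin_Int)
    qed
    show "L \<noteq> {}" if L: "L \<in> range C" for L
    proof -
      obtain n where n: "L = C n" using L by blast
      obtain m where "m \<in> M \<inter> K" "D m g \<in> V n" using ex by blast
      then have "m \<in> L" unfolding n C_def using compactin_subset_topspace[OF K] by blast
      then show ?thesis by blast
    qed
    show "L \<subseteq> L' \<or> L' \<subseteq> L" if L: "L \<in> range C" "L' \<in> range C" for L L'
    proof -
      obtain n n' where n: "L = C n" "L' = C n'" using L by blast
      show ?thesis
        using filtration_antimono[OF V, of n n'] filtration_antimono[OF V, of n' n] linear[of n n']
        unfolding n C_def by blast
    qed
  qed simp
  then obtain m where "\<And>n. m \<in> C n" by blast
  then show ?thesis unfolding C_def by blast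
qed

lemma gyr_stable_Int:
  assumes "gyr_stable A" "gyr_stable B" shows "gyr_stable (A \<inter> B)"
  using assms unfolding gyr_stable_def image_subset_iff by auto

lemma gyr_stable_Inter_filtration:
  assumes V: "filtration V" shows "gyr_stable (\<Inter>n. V n)"
  using V unfolding filtration_def gyr_stable_def by blast

lemma filtration_D_Inter:
  assumes V: "filtration V" and "a \<in> (\<Inter>n. V n)" "b \<in> (\<Inter>n. V n)"
  shows "D a b \<in> (\<Inter>n. V n)"
  using assms unfolding filtration_def by blast

lemma closedin_Inter_filtration:
  assumes V: "filtration V" shows "closedin T (\<Inter>n. V n)"
  using V unfolding filtration_def by auto

lemma cpt_sub_Inter_filtration:
  assumes V: "filtration V" and K: "compactin T K" "V (Suc 0) \<subseteq> K"
  shows "cpt_sub (\<Inter>n. V n)"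
proof -
  have "(\<Inter>n. V n) \<subseteq> K" using K by blast
  then have "compactin T (\<Inter>n. V n)"
    using closed_compactin[OF K(1)] closedin_Inter_filtration[OF V] by blast
  then show ?thesis
    unfolding cpt_sub_def using gyr_stable_Inter_filtration[OF V] filtration_D_Inter[OF V] by blast
qed

lemma cpt_sub_Int_filtration:
  assumes V: "filtration V" and N: "cpt_sub N"
  shows "cpt_sub (N \<inter> (\<Inter>n. V n))"
proof -
  have "compactin T (N \<inter> (\<Inter>n. V n))"
    using cpt_subD(1)[OF N] closedin_Inter_filtration[OF V] by (rule compact_Int_closedin)
  moreover have "gyr_stable (N \<inter> (\<Inter>n. V n))"
    using gyr_stable_Int[OF _ gyr_stable_Inter_filtration[OF V]] N unfolding cpt_sub_def by blast
  ultimately show ?thesis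
    unfolding cpt_sub_def using filtration_D_Inter[OF V] cpt_subD(5)[OF N] by simp
qed

section \<open>Locally finite sets generating up to a compact subgyrogroup\<close>

text \<open>The condition is imposed at all points of \<open>G\<close>, not just at those of
  \<open>E\<close>; this makes the intersection with every compact set finite.\<close>

definition locally_finite :: "'a set \<Rightarrow> bool" where
  "locally_finite E \<longleftrightarrow> E \<subseteq> G \<and> (\<forall>p\<in>G. \<exists>Q. openin T Q \<and> p \<in> Q \<and> finite (Q \<inter> E))"

lemma locally_finite_Un:
  assumes "locally_finite A" "locally_finite B" shows "locally_finite (A \<union> B)"
  unfolding locally_finite_def
proof (intro conjI ballI)
  fix p assume p: "p \<in> G"
  obtain Q where "openin T Q \<and> p \<in> Q \<and> finite (Q \<inter> A)"
    using assms(1) p unfolding locally_finite_def by meson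
  moreover obtain R where "openin T R \<and> p \<in> R \<and> finite (R \<inter> B)"
    using assms(2) p unfolding locally_finite_def by meson
  moreover have "(Q \<inter> R) \<inter> (A \<union> B) \<subseteq> (Q \<inter> A) \<union> (R \<inter> B)" by blast
  ultimately show "\<exists>Q. openin T Q \<and> p \<in> Q \<and> finite (Q \<inter> (A \<union> B))"
    by (intro exI[of _ "Q \<inter> R"]) (auto intro: finite_subset)
qed (use assms in \<open>auto simp: locally_finite_def\<close>)

lemma locally_finite_Int_compact:
  assumes A: "locally_finite A" and K: "compactin T K" shows "finite (A \<inter> K)"
proof -
  obtain Q where Q: "\<And>p. p \<in> G \<Longrightarrow> openin T (Q p) \<and> p \<in> Q p \<and> finite (Q p \<inter> A)"
    using A unfolding locally_finite_def by metis
  have KG: "K \<subseteq> G" using compactin_subset_topspace[OF K] .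
  have "\<exists>\<F>. finite \<F> \<and> \<F> \<subseteq> Q ` K \<and> K \<subseteq> \<Union>\<F>"
    by (rule compactinD[OF K]) (use Q KG in auto)
  then obtain \<F> where F: "finite \<F>" "\<F> \<subseteq> Q ` K" "K \<subseteq> \<Union>\<F>" by blast
  from finite_subset_image[OF F(1,2)] F(3)
  obtain B where B: "finite B" "B \<subseteq> K" "K \<subseteq> \<Union>(Q ` B)" by auto
  have "finite (\<Union>b\<in>B. Q b \<inter> A)" using B(1,2) Q KG by (intro finite_UN_I) auto
  then show ?thesis by (rule finite_subset[rotated]) (use B in blast)
qed

text \<open>A maximal \<open>V (Suc n)\<close>-separated set works: separation makes it locally
  finite, maximality makes it a net.\<close>

lemma locally_finite_net:
  assumes V: "filtration V"
  shows "\<exists>A. locally_finite A \<and> (\<forall>g\<in>G. \<exists>a\<in>A. D a g \<in> V n)"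
proof -
  define sep where "sep = {A. A \<subseteq> G \<and> (\<forall>a\<in>A. \<forall>b\<in>A. D a b \<in> V (Suc n) \<longrightarrow> a = b)}"
  have "\<exists>A\<in>sep. \<forall>X\<in>sep. A \<subseteq> X \<longrightarrow> X = A"
  proof (rule subset_Zorn_nonempty)
    show "sep \<noteq> {}" unfolding sep_def by blast
    fix C assume C: "C \<noteq> {}" "subset.chain sep C"
    have "D a b \<in> V (Suc n) \<longrightarrow> a = b" if ab: "a \<in> \<Union>C" "b \<in> \<Union>C" for a b
    proof -
      obtain X Y where "X \<in> C" "Y \<in> C" "a \<in> X" "b \<in> Y" using ab by blast
      then obtain Z where "Z \<in> C" "a \<in> Z" "b \<in> Z"
        using C(2) unfolding subset_chain_def by blast
      then show ?thesis using C(2) unfolding subset_chain_def sep_def by blast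
    qed
    moreover have "\<Union>C \<subseteq> G" using C(2) unfolding subset_chain_def sep_def by blast
    ultimately show "\<Union>C \<in> sep" unfolding sep_def by blast
  qed
  then obtain A where A: "A \<in> sep" "\<And>X. X \<in> sep \<Longrightarrow> A \<subseteq> X \<Longrightarrow> X = A" by blast
  have AG: "A \<subseteq> G" and Asep: "\<And>a b. a \<in> A \<Longrightarrow> b \<in> A \<Longrightarrow> D a b \<in> V (Suc n) \<Longrightarrow> a = b"
    using A(1) unfolding sep_def by blast+
  have "\<exists>Q. openin T Q \<and> p \<in> Q \<and> finite (Q \<inter> A)" if p: "p \<in> G" for p
  proof -
    obtain Q where Q: "openin T Q" "p \<in> Q" "\<And>y. y \<in> Q \<Longrightarrow> D p y \<in> V (Suc (Suc n))"
      using filtration_neighbourhood[OF V p] by meson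
    \<comment> \<open>Two points that are \<open>V (Suc (Suc n))\<close>-close to \<open>p\<close>
      are \<open>V (Suc n)\<close>-close to each other, so \<open>Q\<close> contains at most one
      point of \<open>A\<close>.\<close>
    have "a = b" if "a \<in> Q \<inter> A" "b \<in> Q \<inter> A" for a b
      using filtration_trans[OF V p, of a b "Suc n"] Q(3) AG Asep that by blast
    then have "\<exists>a. Q \<inter> A \<subseteq> {a}" by blast
    then have "finite (Q \<inter> A)" by (meson finite.simps finite_subset)
    then show ?thesis using Q by blast
  qed
  then have "locally_finite A" unfolding locally_finite_def using AG by blast
  moreover have "\<exists>a\<in>A. D a g \<in> V n" if g: "g \<in> G" for g
  proof (cases "g \<in> A")
    case True
    then show ?thesis using g filtration_zero[OF V] by (intro bexI[of _ g]) simp_all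
  next
    case False
    \<comment> \<open>By maximality \<open>g\<close> is \<open>V (Suc n)\<close>-close to some point
      of \<open>A\<close>, in one order or the other; reversing the order costs one index.\<close>
    then have "insert g A \<notin> sep" using A(2)[of "insert g A"] by blast
    then obtain a where "a \<in> A" "D a g \<in> V (Suc n) \<or> D g a \<in> V (Suc n)"
      using g AG Asep unfolding sep_def by blast
    then show ?thesis
      using filtration_Suc[OF V, of n] filtration_sym[OF V g, of a n] AG by blast
  qed
  ultimately show ?thesis by blast
qed

lemma locally_finite_cofinal:
  "\<exists>E N. locally_finite E \<and> cpt_sub N \<and>
     (\<forall>g\<in>G. \<exists>m\<in>T closure_of (gyro_span G add E). D m g \<in> N)"
proof -
  obtain W K where WK: "openin T W" "compactin T K" "zero \<in> W" "W \<subseteq> K"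
    using lc zero_closed unfolding locally_compact_space_def by meson
  obtain V where V: "filtration V" "V (Suc 0) \<subseteq> W"
    using filtration_exists[OF WK(1,3)] by blast
  have cV: "compactin T (V n)" if "n > 0" for n
  proof (rule closed_compactin[OF WK(2)])
    show "V n \<subseteq> K" using filtration_antimono[OF V(1), of "Suc 0" n] V(2) WK(4) that by auto
    show "closedin T (V n)" using V unfolding filtration_def by blast
  qed
  obtain A where A: "locally_finite A" "\<And>g. g \<in> G \<Longrightarrow> \<exists>a\<in>A. D a g \<in> V 3"
    using locally_finite_net[OF V(1)] by meson
  have AG: "A \<subseteq> G" using A unfolding locally_finite_def by blast
  show ?thesis
  proof (cases "finite A")
    case True
    \<comment> \<open>Finitely many compact translates cover \<open>G\<close>, so \<open>G\<close>
      itself serves as \<open>N\<close> and no generators are needed.\<close>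
    have "G = (\<Union>a\<in>A. coset a (V 3))"
      using A(2) AG unfolding coset_def by blast
    moreover have "compactin T (\<Union>a\<in>A. coset a (V 3))"
      using True AG coset_compact[OF cV[of 3]] by (intro compactin_Union) auto
    ultimately have "compactin T G" by simp
    then have "cpt_sub G" unfolding cpt_sub_def gyr_stable_def by auto
    moreover have "locally_finite {}" unfolding locally_finite_def using openin_topspace by auto
    moreover have "\<forall>g\<in>G. \<exists>m\<in>T closure_of (gyro_span G add {}). D m g \<in> G"
      using closure_span(2,7)[of "{}"] by (auto intro!: bexI[of _ zero])
    ultimately show ?thesis by blast
  next
    case False
    obtain B where B: "\<And>n. finite (B n) \<and> B n \<subseteq> V 3 \<and> (\<forall>g\<in>V 3. \<exists>b\<in>B n. D b g \<in> V n)"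
      using filtration_finite_cover[OF V(1) cV[of 3]] by (metis zero_less_numeral)
    define Q where "Q = (\<Union>n. B n)"
    have Q: "countable Q" "Q \<subseteq> V 3" "Q \<subseteq> G"
      unfolding Q_def using B filtration_subset[OF V(1), of 3] by (auto intro: countable_finite)
    obtain f :: "'a \<Rightarrow> nat" where f: "inj_on f Q" using Q(1) by (rule countableE)
    obtain e :: "nat \<Rightarrow> 'a" where e: "inj e" "range e \<subseteq> A"
      using infinite_countable_subset[OF False] by blast
    define j where "j = e \<circ> f"
    have j: "inj_on j Q" "j ` Q \<subseteq> A"
      unfolding j_def using comp_inj_on[OF f inj_on_subset[OF e(1)]] e(2) by auto
    \<comment> \<open>The summands \<open>j d\<close> spread the points out along \<open>A\<close>,
      yet each \<open>d\<close> is recovered as the difference of \<open>j d\<close> and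
      \<open>add (j d) d\<close>, both of which will be generators.\<close>
    define E2 where "E2 = (\<lambda>d. add (j d) d) ` Q"
    have jG: "d \<in> Q \<Longrightarrow> j d \<in> G" for d using j AG by blast
    have "locally_finite E2"
      unfolding locally_finite_def
    proof (intro conjI ballI)
      show "E2 \<subseteq> G" unfolding E2_def using jG Q by auto
      fix p assume p: "p \<in> G"
      obtain R where R: "openin T R" "p \<in> R" "\<And>y. y \<in> R \<Longrightarrow> D p y \<in> V 3"
        using filtration_neighbourhood[OF V(1) p] by meson
      \<comment> \<open>Two reversals and one use of transitivity lead from index 3 to index 1,
        where the coset is still compact. It contains finitely many points of \<open>A\<close>, and
        \<open>j\<close> is injective.\<close>
      have "j d \<in> A \<inter> coset p (V (Suc 0))" if d: "d \<in> Q" "add (j d) d \<in> R" for d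
      proof -
        let ?y = "add (j d) d"
        have y: "?y \<in> G" using d Q jG by auto
        have dV: "D (j d) ?y \<in> V 3" using D_add[OF jG[OF d(1)] subsetD[OF Q(3) d(1)]] subsetD[OF Q(2) d(1)] by simp
        have "D ?y p \<in> V 2" "D ?y (j d) \<in> V 2"
          using filtration_sym[OF V(1), of p ?y 2] filtration_sym[OF V(1), of "j d" ?y 2]
            R(3)[OF d(2)] p jG[OF d(1)] y dV unfolding eval_nat_numeral by blast+
        then have "D p (j d) \<in> V (Suc 0)"
          using filtration_trans[OF V(1) y p jG[OF d(1)], of "Suc 0"] by (simp add: eval_nat_numeral)
        then show ?thesis using j d jG unfolding coset_def by blast
      qed
      then have "j ` {d \<in> Q. add (j d) d \<in> R} \<subseteq> A \<inter> coset p (V (Suc 0))" by blast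
      moreover have "finite (A \<inter> coset p (V (Suc 0)))"
        by (rule locally_finite_Int_compact[OF A(1) coset_compact[OF cV p]]) simp
      ultimately have "finite (j ` {d \<in> Q. add (j d) d \<in> R})" by (rule finite_subset)
      moreover have "inj_on j {d \<in> Q. add (j d) d \<in> R}" using j(1) by (rule inj_on_subset) blast
      ultimately have "finite {d \<in> Q. add (j d) d \<in> R}" by (rule finite_imageD)
      then have "finite ((\<lambda>d. add (j d) d) ` {d \<in> Q. add (j d) d \<in> R})" by simp
      then have "finite (R \<inter> E2)" by (rule finite_subset[rotated]) (auto simp: E2_def)
      then show "\<exists>R. openin T R \<and> p \<in> R \<and> finite (R \<inter> E2)" using R by blast
    qed
    define E where "E = A \<union> E2"
    have lfE: "locally_finite E" unfolding E_def by (rule locally_finite_Un) fact+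
    then have EG: "E \<subseteq> G" unfolding locally_finite_def by blast
    let ?M = "T closure_of (gyro_span G add E)"
    note M = closure_span[OF EG]
    have QM: "d \<in> ?M" if d: "d \<in> Q" for d
    proof -
      have "j d \<in> E" "add (j d) d \<in> E" unfolding E_def E2_def using d j by auto
      then have "D (j d) (add (j d) d) \<in> gyro_span G add E" using M(1,5) by blast
      moreover have "D (j d) (add (j d) d) = d"
        by (rule D_add[OF jG[OF d] subsetD[OF Q(3) d]])
      ultimately show ?thesis using M(2) by auto
    qed
    have "\<exists>m\<in>?M. D m g \<in> (\<Inter>n. V n)" if g: "g \<in> G" for g
    proof -
      obtain a where a: "a \<in> A" "D a g \<in> V 3" using A(2) g by blast
      have aM: "a \<in> ?M" using a M(1,2) unfolding E_def by blast
      have aG: "a \<in> G" using a AG by blast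
      \<comment> \<open>A point \<open>a\<close> of the net brings \<open>D a g\<close> into
        \<open>V 3\<close>, where a point \<open>d\<close> of \<open>Q\<close> approximates it; then
        \<open>add a d\<close> approximates \<open>g\<close> equally well.\<close>
      have app: "\<exists>m\<in>?M. D m g \<in> V n" for n
      proof -
        obtain d where "d \<in> B n" "D d (D a g) \<in> V n" using B[of n] a(2) by auto
        then have d: "d \<in> Q" "D d (D a g) \<in> V n" unfolding Q_def by auto
        have "D (add a d) g = D (add a d) (add a (D a g))" using aG g by simp
        also have "\<dots> = gyr G add a d (D d (D a g))"
          using D_add_add[of a d "D a g"] d Q aG g by auto
        also have "\<dots> \<in> V n"
          using d aG Q V(1) unfolding filtration_def gyr_stable_def by blast
        finally show ?thesis using M(6)[OF aM QM[OF d(1)]] by blast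
      qed
      have "\<exists>m\<in>?M \<inter> coset g (V (Suc 0)). \<forall>n. D m g \<in> V n"
      proof (rule filtration_limit_point[OF V(1) M(3) coset_compact[OF cV g] g])
        fix n
        \<comment> \<open>Index at least 2 ensures that, after reversal, all approximants lie in the
          same compact set \<open>coset g (V (Suc 0))\<close>.\<close>
        obtain m where m: "m \<in> ?M" "D m g \<in> V (max n 2)" using app by blast
        then have "D m g \<in> V n" "D m g \<in> V 2"
          using filtration_antimono[OF V(1), of n "max n 2"] filtration_antimono[OF V(1), of 2 "max n 2"]
          by auto
        moreover have "m \<in> G" using m M(4) by blast
        ultimately have "m \<in> coset g (V (Suc 0))"
          using filtration_sym[OF V(1), of m g "Suc 0"] g unfolding coset_def
          by (simp add: eval_nat_numeral)
        then show "\<exists>m\<in>?M \<inter> coset g (V (Suc 0)). D m g \<in> V n" using m \<open>D m g \<in> V n\<close> by blast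
      qed simp
      then show ?thesis by blast
    qed
    moreover have "cpt_sub (\<Inter>n. V n)"
      using cpt_sub_Inter_filtration[OF V(1) WK(2)] V(2) WK(4) by blast
    ultimately show ?thesis using lfE by blast
  qed
qed

section \<open>Families of cosets and their refinement\<close>

abbreviation "gen_closure A \<equiv> T closure_of (gyro_span G add A)"

lemma gyro_span_minimal:
  assumes "B \<subseteq> G" "A \<subseteq> gyro_span G add B" shows "gen_closure A \<subseteq> gen_closure B"
  using assms subgyrogroup_gyro_span[OF gyro assms(1)]
  by (intro closure_of_mono) (simp add: gyro_span_def hull_minimal)

text \<open>
  The family of cosets is indexed by all of \<open>'a set \<times> 'a\<close>. An index \<open>(M, a)\<close> with \<open>M \<subseteq> N\<close> is still
  unused and carries the trivial coset, so \<open>(N, a)\<close> can hold the coset of a new generator \<open>a\<close> when \<open>N\<close>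
  is shrunk, and \<open>N = \<Phi> ({}, a)\<close> can be read off the family.
\<close>

definition lifting :: "'a set \<Rightarrow> 'a set \<Rightarrow> ('a set \<times> 'a \<Rightarrow> 'a set) \<Rightarrow> bool" where
  "lifting E N \<Phi> \<longleftrightarrow> cpt_sub N \<and> (\<forall>x. \<exists>g\<in>G. \<Phi> x = coset g N) \<and>
     (\<forall>M a. M \<subseteq> N \<longrightarrow> \<Phi> (M, a) = N) \<and>
     (\<forall>U. openin T U \<and> N \<subseteq> U \<longrightarrow> finite {x. \<not> \<Phi> x \<subseteq> U}) \<and>
     (\<forall>F. (\<forall>x. F x \<in> \<Phi> x) \<longrightarrow> (\<forall>g\<in>G. \<exists>m\<in>gen_closure (E \<union> range F). D m g \<in> N))"

lemma liftingD:
  assumes "lifting E N \<Phi>"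
  shows "cpt_sub N" "\<And>x. \<exists>g\<in>G. \<Phi> x = coset g N" "\<And>M a. M \<subseteq> N \<Longrightarrow> \<Phi> (M, a) = N"
    "\<And>U. openin T U \<Longrightarrow> N \<subseteq> U \<Longrightarrow> finite {x. \<not> \<Phi> x \<subseteq> U}"
    "\<And>F g. (\<And>x. F x \<in> \<Phi> x) \<Longrightarrow> g \<in> G \<Longrightarrow> \<exists>m\<in>gen_closure (E \<union> range F). D m g \<in> N"
  using assms unfolding lifting_def by (simp_all del: split_paired_All)

lemma lifting_coset: "lifting E N \<Phi> \<Longrightarrow> g \<in> \<Phi> x \<Longrightarrow> \<Phi> x = coset g N"
  using liftingD(1,2) coset_eq by metis

lemma lifting_subset: "lifting E N \<Phi> \<Longrightarrow> \<Phi> x \<subseteq> G"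
  using liftingD(2) coset_subset by metis

lemma lifting_nonempty: "lifting E N \<Phi> \<Longrightarrow> \<Phi> x \<noteq> {}"
  using liftingD(1,2) coset_self by blast

lemma lifting_compact: "lifting E N \<Phi> \<Longrightarrow> compactin T (\<Phi> x)"
  using liftingD(1,2) coset_compact cpt_subD(1) by metis

text \<open>This is the starting point for Zorn's lemma: all cosets are trivial and \<open>E\<close>
  alone generates up to \<open>N\<close>.\<close>

lemma lifting_initial:
  assumes E: "E \<subseteq> G" and N: "cpt_sub N" and gen: "\<forall>g\<in>G. \<exists>m\<in>gen_closure E. D m g \<in> N"
  shows "lifting E N (\<lambda>_. N)"
  unfolding lifting_def
proof (intro conjI allI impI ballI)
  show "cpt_sub N" by fact
  show "\<exists>g\<in>G. N = coset g N" using coset_zero[OF N] by (intro bexI[of _ zero]) simp_all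
  show "finite {x. \<not> N \<subseteq> U}" if "openin T U \<and> N \<subseteq> U" for U using that by simp
  fix F :: "'a set \<times> 'a \<Rightarrow> 'a" and g
  assume F: "\<forall>x. F x \<in> N" and g: "g \<in> G"
  have "E \<union> range F \<subseteq> G" using E F cpt_subD(2)[OF N] by blast
  from gyro_span_minimal[OF this, of E] closure_span(1)[OF this]
  show "\<exists>m\<in>gen_closure (E \<union> range F). D m g \<in> N" using gen g by blast
qed simp

text \<open>Compactness gives each limit coset a point, puts some \<open>N \<Phi>\<close> inside any
  open set around the limit subgyrogroup, and yields one approximant of \<open>g\<close> that is
  good for all members of the chain.\<close>

lemma lifting_chain:
  assumes E: "E \<subseteq> G" and ne: "\<C> \<noteq> {}" and lift: "\<And>\<Phi>. \<Phi> \<in> \<C> \<Longrightarrow> lifting E (N \<Phi>) \<Phi>"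
    and chain: "\<And>\<Phi> \<Psi>. \<Phi> \<in> \<C> \<Longrightarrow> \<Psi> \<in> \<C> \<Longrightarrow> (\<forall>x. \<Phi> x \<subseteq> \<Psi> x) \<or> (\<forall>x. \<Psi> x \<subseteq> \<Phi> x)"
  shows "lifting E (\<Inter>\<Phi>\<in>\<C>. N \<Phi>) (\<lambda>x. \<Inter>\<Phi>\<in>\<C>. \<Phi> x)"
proof -
  define N0 where "N0 = (\<Inter>\<Phi>\<in>\<C>. N \<Phi>)"
  \<comment> \<open>Since the subgyrogroup is a value of the family, comparable families have
    comparable subgyrogroups.\<close>
  have Neq: "N \<Phi> = \<Phi> ({}, zero)" if "\<Phi> \<in> \<C>" for \<Phi>
    using liftingD(3)[OF lift[OF that], of "{}"] by simp
  have Nchain: "N \<Phi> \<subseteq> N \<Psi> \<or> N \<Psi> \<subseteq> N \<Phi>" if "\<Phi> \<in> \<C>" "\<Psi> \<in> \<C>" for \<Phi> \<Psi>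
    using chain[OF that] unfolding Neq[OF that(1)] Neq[OF that(2)] by blast
  note sub = liftingD(1)[OF lift]
  obtain \<Phi>0 where \<Phi>0: "\<Phi>0 \<in> \<C>" using ne by blast
  have "closedin T N0" unfolding N0_def using ne cpt_subD(4)[OF sub] by blast
  moreover have "N0 \<subseteq> N \<Phi>0" unfolding N0_def using \<Phi>0 by blast
  ultimately have "compactin T N0"
    using closed_compactin[OF cpt_subD(1)[OF sub[OF \<Phi>0]]] by blast
  moreover have "gyr_stable N0"
    unfolding gyr_stable_def image_subset_iff
  proof (intro conjI ballI)
    show "N0 \<subseteq> G" using \<Phi>0 cpt_subD(2)[OF sub] unfolding N0_def by blast
    show "zero \<in> N0" using cpt_subD(3)[OF sub] unfolding N0_def by blast
    show "gyr G add x y c \<in> N0" if "x \<in> G" "y \<in> G" "c \<in> N0" for x y c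
      using sub that unfolding N0_def cpt_sub_def gyr_stable_def image_subset_iff by blast
  qed
  moreover have "D a b \<in> N0" if "a \<in> N0" "b \<in> N0" for a b
    using that cpt_subD(5)[OF sub] unfolding N0_def by blast
  ultimately have N0: "cpt_sub N0" unfolding cpt_sub_def by blast
  show ?thesis
    unfolding lifting_def N0_def[symmetric]
  proof (intro conjI allI impI ballI)
    show "cpt_sub N0" by (rule N0)
  next
    fix x
    have "\<Inter>((\<lambda>\<Phi>. \<Phi> x) ` \<C>) \<noteq> {}"
    proof (rule compact_chain_Inter_nonempty[OF haus])
      show "K \<subseteq> L \<or> L \<subseteq> K" if KL: "K \<in> (\<lambda>\<Phi>. \<Phi> x) ` \<C>" "L \<in> (\<lambda>\<Phi>. \<Phi> x) ` \<C>" for K L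
      proof -
        obtain \<Phi> \<Psi> where "\<Phi> \<in> \<C>" "\<Psi> \<in> \<C>" "K = \<Phi> x" "L = \<Psi> x" using KL by blast
        then show ?thesis using chain[of \<Phi> \<Psi>] by blast
      qed
    qed (use ne lifting_compact[OF lift, of _ x] lifting_nonempty[OF lift, of _ x] in auto)
    then obtain g where g: "\<And>\<Phi>. \<Phi> \<in> \<C> \<Longrightarrow> g \<in> \<Phi> x" by blast
    have eq: "\<Phi> x = coset g (N \<Phi>)" if "\<Phi> \<in> \<C>" for \<Phi> by (rule lifting_coset[OF lift[OF that] g[OF that]])
    have "g \<in> G" using g[OF \<Phi>0] lifting_subset[OF lift[OF \<Phi>0]] by blast
    moreover have "(\<Inter>\<Phi>\<in>\<C>. \<Phi> x) = (\<Inter>\<Phi>\<in>\<C>. coset g (N \<Phi>))" using eq by simp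
    moreover have "\<dots> = coset g N0" using \<Phi>0 unfolding N0_def coset_def by blast
    ultimately show "\<exists>g\<in>G. (\<Inter>\<Phi>\<in>\<C>. \<Phi> x) = coset g N0" by auto
  next
    fix M a assume "M \<subseteq> N0"
    then have "\<Phi> (M, a) = N \<Phi>" if "\<Phi> \<in> \<C>" for \<Phi>
      using liftingD(3)[OF lift[OF that]] that unfolding N0_def by blast
    then show "(\<Inter>\<Phi>\<in>\<C>. \<Phi> (M, a)) = N0" unfolding N0_def by simp
  next
    fix U assume U: "openin T U \<and> N0 \<subseteq> U"
    have "\<exists>K\<in>N ` \<C>. K \<subseteq> U"
    proof (rule compact_chain_Inter_subset_open[OF haus])
      show "K \<subseteq> L \<or> L \<subseteq> K" if "K \<in> N ` \<C>" "L \<in> N ` \<C>" for K L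
        using that Nchain by blast
    qed (use ne U cpt_subD(1)[OF sub] in \<open>auto simp: N0_def\<close>)
    then obtain \<Phi> where \<Phi>: "\<Phi> \<in> \<C>" "N \<Phi> \<subseteq> U" by blast
    have "{x. \<not> (\<Inter>\<Phi>\<in>\<C>. \<Phi> x) \<subseteq> U} \<subseteq> {x. \<not> \<Phi> x \<subseteq> U}" using \<Phi>(1) by blast
    then show "finite {x. \<not> (\<Inter>\<Phi>\<in>\<C>. \<Phi> x) \<subseteq> U}"
      using liftingD(4)[OF lift[OF \<Phi>(1)], of U] U \<Phi>(2) finite_subset by blast
  next
    fix F g assume F: "\<forall>x. F x \<in> (\<Inter>\<Phi>\<in>\<C>. \<Phi> x)" and g: "g \<in> G"
    let ?M = "gen_closure (E \<union> range F)"
    have "range F \<subseteq> G" using F lifting_subset[OF lift[OF \<Phi>0]] \<Phi>0 by blast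
    then have EF: "E \<union> range F \<subseteq> G" using E by blast
    have cc: "compactin T (coset g (N \<Phi>) \<inter> ?M)" if "\<Phi> \<in> \<C>" for \<Phi>
      using coset_compact[OF cpt_subD(1)[OF sub[OF that]] g] closure_span(3)[OF EF]
      by (rule compact_Int_closedin)
    have cne: "coset g (N \<Phi>) \<inter> ?M \<noteq> {}" if Phi: "\<Phi> \<in> \<C>" for \<Phi>
    proof -
      obtain m where m: "m \<in> ?M" "D m g \<in> N \<Phi>"
        using liftingD(5)[OF lift[OF Phi], of F g] F g Phi by blast
      then have "m \<in> coset g (N \<Phi>)"
        using cpt_sub_sym[OF sub[OF Phi]] closure_span(4)[OF EF] g unfolding coset_def by blast
      then show ?thesis using m by blast
    qed
    have "\<Inter>((\<lambda>\<Phi>. coset g (N \<Phi>) \<inter> ?M) ` \<C>) \<noteq> {}"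
    proof (rule compact_chain_Inter_nonempty[OF haus])
      show "K \<subseteq> L \<or> L \<subseteq> K" if KL: "K \<in> (\<lambda>\<Phi>. coset g (N \<Phi>) \<inter> ?M) ` \<C>"
        "L \<in> (\<lambda>\<Phi>. coset g (N \<Phi>) \<inter> ?M) ` \<C>" for K L
      proof -
        obtain \<Phi> \<Psi> where "\<Phi> \<in> \<C>" "\<Psi> \<in> \<C>" "K = coset g (N \<Phi>) \<inter> ?M" "L = coset g (N \<Psi>) \<inter> ?M"
          using KL by blast
        then show ?thesis using Nchain[of \<Phi> \<Psi>] unfolding coset_def by blast
      qed
    qed (use ne cc cne in auto)
    then obtain m where m: "\<And>\<Phi>. \<Phi> \<in> \<C> \<Longrightarrow> m \<in> coset g (N \<Phi>) \<inter> ?M" by blast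
    then have "m \<in> ?M" "m \<in> G" "D g m \<in> N0" using \<Phi>0 unfolding N0_def coset_def by blast+
    then show "\<exists>m\<in>?M. D m g \<in> N0" using cpt_sub_sym[OF N0 g] by blast
  qed
qed

text \<open>Sums of two elements of \<open>N\<close> lie in \<open>U\<close>, and by Wallace's
  theorem this persists on a product neighbourhood of \<open>N \<times> N\<close>.\<close>

lemma coset_subset_open_neighbourhood:
  assumes N: "cpt_sub N" and U: "openin T U" "N \<subseteq> U"
  shows "\<exists>Q. openin T Q \<and> N \<subseteq> Q \<and> (\<forall>g\<in>Q. coset g N \<subseteq> U)"
proof -
  define R where "R = {p \<in> topspace (prod_topology T T). (\<lambda>(x, y). add x y) p \<in> U}"
  have "openin (prod_topology T T) R"
    unfolding R_def by (rule openin_continuous_map_preimage[OF cont_add U(1)])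
  moreover have "N \<times> N \<subseteq> R"
    unfolding R_def using cpt_subD(2,6)[OF N] U(2) by auto
  ultimately obtain Q Q' where Q: "openin T Q" "openin T Q'" "N \<subseteq> Q" "N \<subseteq> Q'" "Q \<times> Q' \<subseteq> R"
    using Wallace_theorem_prod_topology[OF cpt_subD(1)[OF N] cpt_subD(1)[OF N]] by metis
  have "coset g N \<subseteq> U" if g: "g \<in> Q" for g
  proof -
    have "g \<in> G" using g openin_subset[OF Q(1)] by blast
    moreover have "add g c \<in> U" if "c \<in> N" for c
    proof -
      have "(g, c) \<in> R" using g \<open>c \<in> N\<close> Q(4,5) by blast
      then show ?thesis unfolding R_def by simp
    qed
    ultimately show ?thesis using coset_image[OF cpt_subD(2)[OF N]] by auto
  qed
  then show ?thesis using Q by blast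
qed

text \<open>For \<open>c\<close> in \<open>N\<close> the point \<open>add c (D c zero)\<close> is
  \<open>zero\<close>, so for \<open>x\<close> near \<open>c\<close> the element
  \<open>add x (D c zero)\<close> of the coset of \<open>x\<close> stays near
  \<open>zero\<close>.\<close>

lemma coset_meets_neighbourhood:
  assumes N: "cpt_sub N" and V: "filtration V"
  shows "\<exists>U. openin T U \<and> N \<subseteq> U \<and> (\<forall>g\<in>U. coset g N \<inter> V n \<noteq> {})"
proof -
  obtain Q where Q: "openin T Q" "zero \<in> Q" "Q \<subseteq> V n"
    using V unfolding filtration_def by meson
  define R where "R c = {x \<in> G. add x (D c zero) \<in> Q}" for c
  have R: "openin T (R c)" "c \<in> R c" if c: "c \<in> N" for c
  proof -
    have cG: "c \<in> G" using c cpt_subD(2)[OF N] by blast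
    show "openin T (R c)" unfolding R_def
      using cG by (intro openin_continuous_map_preimage[OF cont_add_args(2) Q(1)]) simp
    show "c \<in> R c" unfolding R_def using cG Q(2) by simp
  qed
  have "coset g N \<inter> V n \<noteq> {}" if g: "c \<in> N" "g \<in> R c" for c g
  proof -
    have "D c zero \<in> N" using g(1) cpt_subD(3,5)[OF N] by blast
    moreover have "g \<in> G" "add g (D c zero) \<in> V n" using g(2) Q(3) unfolding R_def by auto
    ultimately show ?thesis using coset_image[OF cpt_subD(2)[OF N]] by blast
  qed
  moreover have "openin T (\<Union>(R ` N))" using R(1) by blast
  moreover have "N \<subseteq> \<Union>(R ` N)" using R(2) by blast
  ultimately show ?thesis by (intro exI[of _ "\<Union>(R ` N)"]) blast
qed

text \<open>The nonempty sets among the \<open>K \<inter> V n\<close> form a chain of compact sets.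
  A common point lies as deep in the filtration as \<open>K\<close> permits, for all
  \<open>n\<close> at once.\<close>

lemma filtration_selection:
  assumes V: "filtration V" and K: "compactin T K" "K \<noteq> {}"
  shows "\<exists>g\<in>K. \<forall>n. K \<inter> V n \<noteq> {} \<longrightarrow> g \<in> V n"
proof -
  define I where "I = {n. K \<inter> V n \<noteq> {}}"
  have "V 0 = G" using V unfolding filtration_def by blast
  then have I0: "0 \<in> I" unfolding I_def using K compactin_subset_topspace[OF K(1)] by blast
  have clV: "closedin T (V n)" for n using V unfolding filtration_def by blast
  have "\<Inter>((\<lambda>n. K \<inter> V n) ` I) \<noteq> {}"
  proof (rule compact_chain_Inter_nonempty[OF haus])
    show "L \<subseteq> L' \<or> L' \<subseteq> L" if L: "L \<in> (\<lambda>n. K \<inter> V n) ` I" "L' \<in> (\<lambda>n. K \<inter> V n) ` I" for L L'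
    proof -
      obtain n n' where "L = K \<inter> V n" "L' = K \<inter> V n'" using L by blast
      then show ?thesis
        using filtration_antimono[OF V, of n n'] filtration_antimono[OF V, of n' n] linear[of n n']
        by blast
    qed
  qed (use I0 compact_Int_closedin[OF K(1) clV] in \<open>auto simp: I_def\<close>)
  then obtain g where "\<And>n. n \<in> I \<Longrightarrow> g \<in> K \<inter> V n" by blast
  then show ?thesis using I0 unfolding I_def by blast
qed

text \<open>Representatives of the smaller cosets also represent the old ones, so they still
  generate up to \<open>N\<close>. The new generators then correct the remaining error inside
  \<open>N\<close>, one level of the filtration at a time.\<close>

lemma lifting_refine:
  assumes E: "E \<subseteq> G" and lift: "lifting E N \<Phi>" and p: "p \<in> N" "p \<noteq> zero"
  shows "\<exists>N' \<Phi>'. lifting E N' \<Phi>' \<and> (\<forall>x. \<Phi>' x \<subseteq> \<Phi> x) \<and> p \<notin> N'"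
proof -
  note N = liftingD(1)[OF lift]
  note NG = cpt_subD(2)[OF N]
  have pG: "p \<in> G" using p NG by blast
  have "openin T (G - {p})" using closedin_Hausdorff_singleton[OF haus pG] by blast
  moreover have "zero \<in> G - {p}" using p by simp
  ultimately obtain V where V: "filtration V" "V (Suc 0) \<subseteq> G - {p}"
    using filtration_exists by blast
  have clV: "closedin T (V n)" for n using V unfolding filtration_def by blast
  have V0: "V 0 = G" using V unfolding filtration_def by blast
  define N' where "N' = N \<inter> (\<Inter>n. V n)"
  have N': "cpt_sub N'" unfolding N'_def by (rule cpt_sub_Int_filtration[OF V(1) N])
  have pN': "p \<notin> N'" using V(2) unfolding N'_def by blast
  have N'N: "N' \<subseteq> N" and N'V: "\<And>n. N' \<subseteq> V n" unfolding N'_def by blast+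
  \<comment> \<open>The accuracy is two levels finer than the set covered: one level is the gain of
    each approximation step, the other pays for replacing a net point by an arbitrary representative
    of its \<open>N'\<close>-coset.\<close>
  have ex: "\<forall>n. \<exists>A. finite A \<and> A \<subseteq> N \<inter> V n \<and> (\<forall>g\<in>N \<inter> V n. \<exists>a\<in>A. D a g \<in> V (Suc (Suc n)))"
    using filtration_finite_cover[OF V(1) compact_Int_closedin[OF cpt_subD(1)[OF N] clV]] by blast
  obtain A where A: "\<And>n. finite (A n)" "\<And>n. A n \<subseteq> N \<inter> V n"
    "\<And>n g. g \<in> N \<Longrightarrow> g \<in> V n \<Longrightarrow> \<exists>a\<in>A n. D a g \<in> V (Suc (Suc n))"
    using choice[OF ex] by blast
  have "\<exists>g\<in>\<Phi> x. (\<Phi> x = N \<longrightarrow> g = zero) \<and> (\<forall>n. \<Phi> x \<inter> V n \<noteq> {} \<longrightarrow> g \<in> V n)" for x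
  proof (cases "\<Phi> x = N")
    case True
    then show ?thesis using cpt_subD(3)[OF N] filtration_zero[OF V(1)] by blast
  next
    case False
    then show ?thesis
      using filtration_selection[OF V(1) lifting_compact[OF lift] lifting_nonempty[OF lift], of x]
      by blast
  qed
  then have "\<forall>x. \<exists>g. g \<in> \<Phi> x \<and> (\<Phi> x = N \<longrightarrow> g = zero) \<and> (\<forall>n. \<Phi> x \<inter> V n \<noteq> {} \<longrightarrow> g \<in> V n)"
    by blast
  from choice[OF this] obtain c where
    "\<forall>x. c x \<in> \<Phi> x \<and> (\<Phi> x = N \<longrightarrow> c x = zero) \<and> (\<forall>n. \<Phi> x \<inter> V n \<noteq> {} \<longrightarrow> c x \<in> V n)" ..
  then have c: "\<And>x. c x \<in> \<Phi> x" "\<And>x. \<Phi> x = N \<Longrightarrow> c x = zero"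
    "\<And>x n. \<Phi> x \<inter> V n \<noteq> {} \<Longrightarrow> c x \<in> V n"
    by blast+
  define h where "h x = (if fst x = N \<and> snd x \<in> (\<Union>n. A n) then snd x else c x)" for x
  define \<Phi>' where "\<Phi>' x = coset (h x) N'" for x
  have \<Phi>N: "\<Phi> (N, a) = N" for a using liftingD(3)[OF lift] by blast
  have h\<Phi>: "h x \<in> \<Phi> x" for x
  proof (cases "fst x = N \<and> snd x \<in> (\<Union>n. A n)")
    case True
    then have "snd x \<in> N" using A(2) by blast
    then show ?thesis using True \<Phi>N[of "snd x"] unfolding h_def by (cases x) auto
  next
    case False
    then show ?thesis unfolding h_def using c(1) by auto
  qed
  have hG: "h x \<in> G" for x using h\<Phi> lifting_subset[OF lift] by blast
  have sub: "\<Phi>' x \<subseteq> \<Phi> x" for x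
    using lifting_coset[OF lift h\<Phi>] N'N unfolding \<Phi>'_def coset_def by blast
  have "lifting E N' \<Phi>'"
    unfolding lifting_def
  proof (intro conjI allI impI ballI)
    show "cpt_sub N'" by (rule N')
    show "\<exists>g\<in>G. \<Phi>' x = coset g N'" for x unfolding \<Phi>'_def using hG by blast
  next
    fix M a assume M: "M \<subseteq> N'"
    \<comment> \<open>The point \<open>p\<close> separates \<open>N\<close> from every subset of
      \<open>N'\<close>, so the index \<open>(M, a)\<close> holds no net point.\<close>
    then have "M \<noteq> N" "M \<subseteq> N" using p pN' N'N by blast+
    then have "h (M, a) = zero"
      unfolding h_def using c(2) liftingD(3)[OF lift] by simp
    then show "\<Phi>' (M, a) = N'" unfolding \<Phi>'_def using coset_zero[OF N'] by simp
  next
    fix U assume U: "openin T U \<and> N' \<subseteq> U"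
    then obtain Q where Q: "openin T Q" "N' \<subseteq> Q" "\<And>g. g \<in> Q \<Longrightarrow> coset g N' \<subseteq> U"
      using coset_subset_open_neighbourhood[OF N', of U] by auto
    have "\<exists>K\<in>range (\<lambda>n. N \<inter> V n). K \<subseteq> Q"
    proof (rule compact_chain_Inter_subset_open[OF haus])
      show "L \<subseteq> L' \<or> L' \<subseteq> L" if L: "L \<in> range (\<lambda>n. N \<inter> V n)" "L' \<in> range (\<lambda>n. N \<inter> V n)" for L L'
      proof -
        obtain n n' where "L = N \<inter> V n" "L' = N \<inter> V n'" using L by blast
        then show ?thesis
          using filtration_antimono[OF V(1), of n n'] filtration_antimono[OF V(1), of n' n]
            linear[of n n'] by blast
      qed
      show "\<Inter>(range (\<lambda>n. N \<inter> V n)) \<subseteq> Q" using Q(2) unfolding N'_def by auto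
    qed (use Q compact_Int_closedin[OF cpt_subD(1)[OF N] clV] in auto)
    then obtain n where n: "N \<inter> V n \<subseteq> Q" by blast
    \<comment> \<open>Three finite sets of indices are discarded: cosets meeting \<open>V n\<close>
      outside \<open>Q\<close>, cosets not contained in \<open>R\<close>, and net points of level
      below \<open>n\<close>. For all other \<open>x\<close> the point \<open>h x\<close> lies in
      \<open>V n\<close>, hence in \<open>Q\<close>.\<close>
    have "closedin T (V n \<inter> (G - Q))" using clV Q(1) by (intro closedin_Int) auto
    then have "openin T (G - (V n \<inter> (G - Q)))" by blast
    then have fin1: "finite {x. \<not> \<Phi> x \<subseteq> G - (V n \<inter> (G - Q))}"
      by (rule liftingD(4)[OF lift]) (use NG n in blast)
    obtain R where R: "openin T R" "N \<subseteq> R" "\<And>g. g \<in> R \<Longrightarrow> coset g N \<inter> V n \<noteq> {}"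
      using coset_meets_neighbourhood[OF N V(1)] by meson
    have fin2: "finite {x. \<not> \<Phi> x \<subseteq> R}" by (rule liftingD(4)[OF lift R(1,2)])
    have fin3: "finite ((\<lambda>a. (N, a)) ` (\<Union>k<n. A k))" using A(1) by blast
    have "\<Phi>' x \<subseteq> U" if x: "\<Phi> x \<subseteq> G - (V n \<inter> (G - Q))" "\<Phi> x \<subseteq> R"
      "x \<notin> (\<lambda>a. (N, a)) ` (\<Union>k<n. A k)" for x
    proof -
      have "h x \<in> V n"
      proof (cases "fst x = N \<and> snd x \<in> (\<Union>n. A n)")
        case True
        then obtain k where k: "snd x \<in> A k" by blast
        have "x = (N, snd x)" using True by (metis prod.collapse)
        then have "\<not> k < n" using x(3) k by blast
        then have "V k \<subseteq> V n" using filtration_antimono[OF V(1), of n k] by simp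
        then show ?thesis using True k A(2)[of k] unfolding h_def by auto
      next
        case False
        have "\<Phi> x \<inter> V n \<noteq> {}"
          using R(3)[of "c x"] lifting_coset[OF lift c(1)] x(2) c(1) by blast
        then show ?thesis using c(3) False unfolding h_def by auto
      qed
      moreover have "h x \<in> G - (V n \<inter> (G - Q))" using x(1) h\<Phi> by blast
      ultimately have "h x \<in> Q" by blast
      then show ?thesis unfolding \<Phi>'_def using Q(3) by blast
    qed
    then have "{x. \<not> \<Phi>' x \<subseteq> U} \<subseteq> {x. \<not> \<Phi> x \<subseteq> G - (V n \<inter> (G - Q))} \<union> {x. \<not> \<Phi> x \<subseteq> R}
        \<union> (\<lambda>a. (N, a)) ` (\<Union>k<n. A k)" by blast
    then show "finite {x. \<not> \<Phi>' x \<subseteq> U}"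
      using fin1 fin2 fin3 by (meson finite_Un finite_subset)
  next
    fix F g assume F: "\<forall>x. F x \<in> \<Phi>' x" and g: "g \<in> G"
    let ?M = "gen_closure (E \<union> range F)"
    have F\<Phi>: "F x \<in> \<Phi> x" for x using F sub by blast
    have "range F \<subseteq> G" using F\<Phi> lifting_subset[OF lift] by blast
    then have EF: "E \<union> range F \<subseteq> G" using E by blast
    note M = closure_span[OF EF]
    have FM: "F x \<in> ?M" for x using M(1,2) by blast
    have stepD: "D (add m b) w \<in> W" if "gyr_stable W" "m \<in> G" "b \<in> G" "w \<in> G" "D b (D m w) \<in> W" for m b w W
      using D_add_add[of m b "D m w"] that unfolding gyr_stable_def image_subset_iff by simp
    \<comment> \<open>The error \<open>D m w\<close> is approximated by a net point
      \<open>a\<close>, whose chosen representative \<open>b\<close> is equally usable;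
      \<open>add m b\<close> then improves \<open>m\<close> by one level.\<close>
    have app: "\<exists>m\<in>?M \<inter> N. D m w \<in> V n" if w: "w \<in> N" for w n
    proof (induction n)
      case 0
      have "zero \<in> ?M \<inter> N" using M(2,7) cpt_subD(3)[OF N] by blast
      then show ?case using w NG V0 by (intro bexI[of _ zero]) auto
    next
      case (Suc n)
      then obtain m where m: "m \<in> ?M" "m \<in> N" "D m w \<in> V n" by blast
      have mw: "D m w \<in> N" using cpt_subD(5)[OF N] m w by blast
      then obtain a where a: "a \<in> A n" "D a (D m w) \<in> V (Suc (Suc n))" using A(3) m(3) by blast
      have aN: "a \<in> N" using a A(2) by blast
      define b where "b = F (N, a)"
      have "h (N, a) = a" unfolding h_def using a by auto
      then have "b \<in> coset a N'" using F unfolding \<Phi>'_def b_def by metis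
      then have ab: "D a b \<in> V (Suc (Suc n))" unfolding coset_def using N'V by blast
      have bN: "b \<in> N" using F\<Phi>[of "(N, a)"] \<Phi>N unfolding b_def by blast
      have bM: "b \<in> ?M" unfolding b_def by (rule FM)
      have inG: "m \<in> G" "b \<in> G" "w \<in> G" "a \<in> G" "D m w \<in> G" using m bN w aN mw NG by blast+
      have "D b (D m w) \<in> V (Suc n)"
        by (rule filtration_trans[OF V(1) inG(4,2,5) ab a(2)])
      then have "D (add m b) w \<in> V (Suc n)"
        using stepD[OF _ inG(1-3)] V(1) unfolding filtration_def by blast
      moreover have "add m b \<in> ?M \<inter> N" using M(6)[OF m(1) bM] cpt_subD(6)[OF N m(2) bN] by blast
      ultimately show ?case by blast
    qed
    have fine: "\<exists>m\<in>?M. m \<in> N \<and> D m w \<in> N'" if w: "w \<in> N" for w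
    proof -
      have "\<exists>m\<in>?M \<inter> N. \<forall>n. D m w \<in> V n"
        using filtration_limit_point[OF V(1) M(3) cpt_subD(1)[OF N] _ app[OF w]] w NG by blast
      then obtain m where "m \<in> ?M" "m \<in> N" "\<forall>n. D m w \<in> V n" by blast
      moreover have "D m w \<in> N" using cpt_subD(5)[OF N] calculation(2) w by blast
      ultimately show ?thesis unfolding N'_def by blast
    qed
    \<comment> \<open>The old family reaches \<open>g\<close> up to \<open>N\<close>, and the error
      in \<open>N\<close> is then reached up to \<open>N'\<close>.\<close>
    obtain m where m: "m \<in> ?M" "D m g \<in> N" using liftingD(5)[OF lift F\<Phi> g] by blast
    obtain m' where m': "m' \<in> ?M" "D m' (D m g) \<in> N'" using fine[OF m(2)] by blast
    have "D (add m m') g \<in> N'"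
      using stepD[of N' m m' g] m m' g M(4) N' unfolding cpt_sub_def by blast
    then show "\<exists>m\<in>?M. D m g \<in> N'" using M(6)[OF m(1) m'(1)] by blast
  qed
  then show ?thesis using sub pN' by blast
qed

text \<open>Zorn's lemma is applied to families ordered by reverse pointwise inclusion; a family
  that cannot be shrunk has trivial subgyrogroup by \<open>lifting_refine\<close>.\<close>

lemma lifting_trivial_exists:
  assumes E: "E \<subseteq> G" and N0: "cpt_sub N0" and gen: "\<forall>g\<in>G. \<exists>m\<in>gen_closure E. D m g \<in> N0"
  shows "\<exists>\<Phi>. lifting E {zero} \<Phi>"
proof -
  define L where "L = {\<Phi>. \<exists>N. lifting E N \<Phi>}"
  define P where "P \<Phi> \<Psi> \<longleftrightarrow> (\<forall>x. \<Psi> x \<subseteq> \<Phi> x)" for \<Phi> \<Psi> :: "'a set \<times> 'a \<Rightarrow> 'a set"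
  have "\<exists>\<Phi>\<in>L. \<forall>\<Psi>\<in>L. P \<Phi> \<Psi> \<longrightarrow> \<Psi> = \<Phi>"
  proof (rule predicate_Zorn)
    show "partial_order_on L (relation_of P L)"
    proof (rule partial_order_on_relation_ofI)
      show "\<Phi> = \<Psi>" if "P \<Phi> \<Psi>" "P \<Psi> \<Phi>" for \<Phi> \<Psi>
        using that unfolding P_def by (intro ext) blast
    qed (unfold P_def, blast+)
    fix \<C> assume C: "\<C> \<in> Chains (relation_of P L)"
    show "\<exists>u\<in>L. \<forall>a\<in>\<C>. P a u"
    proof (cases "\<C> = {}")
      case True
      then show ?thesis using lifting_initial[OF E N0 gen] unfolding L_def by blast
    next
      case False
      have CL: "\<C> \<subseteq> L" and ch: "\<And>\<Phi> \<Psi>. \<Phi> \<in> \<C> \<Longrightarrow> \<Psi> \<in> \<C> \<Longrightarrow> P \<Psi> \<Phi> \<or> P \<Phi> \<Psi>"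
        using C unfolding Chains_def relation_of_def by blast+
      have "\<forall>\<Phi>\<in>\<C>. \<exists>N. lifting E N \<Phi>" using CL unfolding L_def by blast
      from bchoice[OF this] obtain N where N: "\<And>\<Phi>. \<Phi> \<in> \<C> \<Longrightarrow> lifting E (N \<Phi>) \<Phi>" by blast
      have "lifting E (\<Inter>\<Phi>\<in>\<C>. N \<Phi>) (\<lambda>x. \<Inter>\<Phi>\<in>\<C>. \<Phi> x)"
        by (rule lifting_chain[OF E False N]) (use ch in \<open>auto simp: P_def\<close>)
      then show ?thesis
        unfolding L_def P_def by (intro bexI[of _ "\<lambda>x. \<Inter>\<Phi>\<in>\<C>. \<Phi> x"]) auto
    qed
  qed
  then obtain \<Phi> N where \<Phi>: "lifting E N \<Phi>" "\<And>\<Psi>. \<Psi> \<in> L \<Longrightarrow> P \<Phi> \<Psi> \<Longrightarrow> \<Psi> = \<Phi>"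
    unfolding L_def by blast
  have "p = zero" if p: "p \<in> N" for p
  proof (rule ccontr)
    assume "p \<noteq> zero"
    from lifting_refine[OF E \<Phi>(1) p this] obtain N' \<Psi>
      where \<Psi>: "lifting E N' \<Psi>" "\<forall>x. \<Psi> x \<subseteq> \<Phi> x" "p \<notin> N'" by blast
    then have "\<Psi> = \<Phi>" using \<Phi>(2) unfolding L_def P_def by blast
    \<comment> \<open>Equal families have the same value at \<open>({}, zero)\<close>, hence the
      same subgyrogroup, but only one of the two contains \<open>p\<close>.\<close>
    then show False
      using liftingD(3)[OF \<Phi>(1), of "{}"] liftingD(3)[OF \<Psi>(1), of "{}"] p \<Psi>(3) by auto
  qed
  then have "N = {zero}" using cpt_subD(3)[OF liftingD(1)[OF \<Phi>(1)]] by blast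
  then show ?thesis using \<Phi>(1) by blast
qed

section \<open>Suitable sets\<close>

text \<open>Points of \<open>S\<close> may accumulate only at \<open>zero\<close>. Near any other
  point there are finitely many, which a Hausdorff topology can remove; \<open>zero\<close> lies in
  every span, so adjoining it generates nothing new.\<close>

lemma suitable_setI:
  assumes S: "S \<subseteq> G - {zero}" and dense: "G \<subseteq> gen_closure (insert zero S)"
    and fin: "\<And>p. p \<in> G \<Longrightarrow> p \<noteq> zero \<Longrightarrow> \<exists>Q. openin T Q \<and> p \<in> Q \<and> finite (Q \<inter> S)"
  shows "suitable_set T add S"
proof -
  have SG: "S \<subseteq> G" using S by blast
  have closed_finite: "closedin T B" if "finite B" "B \<subseteq> G" for B
    using that compactin_imp_closedin[OF haus] finite_imp_compactin by blast
  have isol: "\<exists>Q. openin T Q \<and> p \<in> Q \<and> Q \<inter> insert zero S \<subseteq> {p}" if p: "p \<in> G" "p \<noteq> zero" for p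
  proof -
    obtain Q where Q: "openin T Q" "p \<in> Q" "finite (Q \<inter> S)" using fin[OF p] by blast
    have "closedin T (insert zero (Q \<inter> S) - {p})"
      using Q(3) SG by (intro closed_finite) auto
    then have "openin T (Q - (insert zero (Q \<inter> S) - {p}))" using Q(1) by blast
    then show ?thesis using Q(2) by (intro exI[of _ "Q - (insert zero (Q \<inter> S) - {p})"]) blast
  qed
  have "subtopology T S = discrete_topology S"
  proof -
    have "openin (subtopology T S) {p}" if p: "p \<in> S" for p
    proof -
      obtain Q where Q: "openin T Q" "p \<in> Q" "Q \<inter> insert zero S \<subseteq> {p}" using isol[of p] p S by blast
      then have "{p} = Q \<inter> S" using p by blast
      then show ?thesis using Q(1) openin_subtopology by blast
    qed
    then have "discrete_topology S = subtopology T S"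
      using SG by (subst discrete_topology_unique) auto
    then show ?thesis by simp
  qed
  moreover have "closedin T (S \<union> {zero})"
  proof -
    have "\<exists>Q. openin T Q \<and> p \<in> Q \<and> Q \<subseteq> G - (S \<union> {zero})" if p: "p \<in> G - (S \<union> {zero})" for p
    proof -
      obtain Q where Q: "openin T Q" "p \<in> Q" "Q \<inter> insert zero S \<subseteq> {p}" using isol[of p] p by blast
      then have "Q \<subseteq> G - (S \<union> {zero})" using p openin_subset[OF Q(1)] by blast
      then show ?thesis using Q by blast
    qed
    then have "openin T (G - (S \<union> {zero}))" by (subst openin_subopen) blast
    then show ?thesis unfolding closedin_def using SG by simp
  qed
  moreover have "gen_closure S = G"
  proof -
    have "insert zero S \<subseteq> gyro_span G add S" using closure_span(1,7)[OF SG] by blast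
    from gyro_span_minimal[OF SG this] show ?thesis
      using dense closure_of_subset_topspace[of T] by blast
  qed
  ultimately show ?thesis unfolding suitable_set_def using SG by blast
qed

lemma suitable_set_exists: "\<exists>S. suitable_set T add S"
proof -
  obtain E N where EN: "locally_finite E" "cpt_sub N" "\<forall>g\<in>G. \<exists>m\<in>gen_closure E. D m g \<in> N"
    using locally_finite_cofinal by blast
  have E: "E \<subseteq> G" using EN(1) unfolding locally_finite_def by blast
  obtain \<Phi> where \<Phi>: "lifting E {zero} \<Phi>" using lifting_trivial_exists[OF E EN(2,3)] by blast
  have "\<forall>x. \<exists>f. f \<in> \<Phi> x" using lifting_nonempty[OF \<Phi>] by blast
  from choice[OF this] obtain F where F: "\<And>x. F x \<in> \<Phi> x" by blast
  have FG: "F x \<in> G" for x using F lifting_subset[OF \<Phi>] by blast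
  have EF: "E \<union> range F \<subseteq> G" using E FG by blast
  define S where "S = (E \<union> range F) - {zero}"
  have SG: "insert zero S \<subseteq> G" unfolding S_def using EF by auto
  have "suitable_set T add S"
  proof (rule suitable_setI)
    show "S \<subseteq> G - {zero}" unfolding S_def using EF by blast
    show "G \<subseteq> gen_closure (insert zero S)"
    proof
      fix g assume g: "g \<in> G"
      obtain m where m: "m \<in> gen_closure (E \<union> range F)" "D m g \<in> {zero}"
        using liftingD(5)[OF \<Phi> F g] by blast
      have mG: "m \<in> G" using m closure_span(4)[OF EF] by blast
      \<comment> \<open>Up to the trivial subgyrogroup, approximation is equality.\<close>
      have "g = m" using m(2) add_D[OF mG g] add_zero[OF mG] by simp
      moreover have "E \<union> range F \<subseteq> gyro_span G add (insert zero S)"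
        using closure_span(1)[OF SG] unfolding S_def by blast
      ultimately show "g \<in> gen_closure (insert zero S)"
        using gyro_span_minimal[OF SG] m(1) by blast
    qed
    fix p assume p: "p \<in> G" "p \<noteq> zero"
    obtain Q where Q: "openin T Q" "p \<in> Q" "finite (Q \<inter> E)"
      using EN(1) p unfolding locally_finite_def by blast
    \<comment> \<open>All but finitely many cosets lie in the neighbourhood \<open>B\<close> of
      \<open>zero\<close>, so \<open>A\<close> contains only finitely many chosen
      representatives.\<close>
    obtain A B where AB: "openin T A" "openin T B" "p \<in> A" "zero \<in> B" "disjnt A B"
      using haus p zero_closed unfolding Hausdorff_space_def by metis
    have "finite {x. \<not> \<Phi> x \<subseteq> B}" using liftingD(4)[OF \<Phi> AB(2)] AB(4) by blast
    moreover have "{x. F x \<notin> B} \<subseteq> {x. \<not> \<Phi> x \<subseteq> B}" using F by blast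
    ultimately have "finite (F ` {x. F x \<notin> B})" using finite_subset by blast
    moreover have "(Q \<inter> A) \<inter> S \<subseteq> (Q \<inter> E) \<union> F ` {x. F x \<notin> B}"
      using AB(5) unfolding S_def disjnt_def by blast
    ultimately have "finite ((Q \<inter> A) \<inter> S)" using Q(3) by (meson finite_Un finite_subset)
    then show "\<exists>Q. openin T Q \<and> p \<in> Q \<and> finite (Q \<inter> S)"
      using Q AB by (intro exI[of _ "Q \<inter> A"]) auto
  qed
  then show ?thesis by blast
qed

end

theorem theorem2p14:
  fixes T :: "'a topology" and add :: "'a \<Rightarrow> 'a \<Rightarrow> 'a"
  assumes "Hausdorff_space T"
    and "locally_compact_space T"
    and "strongly_topological_gyrogroup T add"
  shows "\<exists>S. suitable_set T add S"
  using assms by (intro lc_strong_gyrogroup.suitable_set_exists lc_strong_gyrogroup.intro)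

end
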